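(* Let $d_1,d_2,s_1,s_2\in\mathbb{N}$, put $S:=s_1+s_2$, $D:=d_1+d_2$, and let $1\le p<2$. Let $r>0$ (with $r>1$ if $p=1$) and set $r_*:=r-1$ if $p=1$ and $r_*:=r$ if $p>1$. Then there exists a constant $c>0$, independent of $r$, such that $$\liminf_{n\to\infty}\Big(\frac{r_*^{D/S}}{n}\Big)^{-\frac{S(p-1)p}{Sp+D(p-1)}}\inf_{\tilde f}\sup_{f\in W^{(s_1,s_2)}_p(r)}\mathbb{E}_f\|\tilde f-f\|_p^p\ge c,$$ where the supremum is over probability density functions $f$ in $W^{(s_1,s_2)}_p(r)$ and the infimum is taken over all possible estimators $\tilde f$ based on an i.i.d. sample of size $n$ from $f$.
   Context: $\mathbb{N}$ denotes the positive integers and $\mathbb{N}_0$ the non-negative integers. For a multi-index $\alpha$, $|\alpha|$ denotes the sum of its entries. Norms $\|\cdot\|_p$ are $L^p$ norms with respect to Lebesgue measure. Sobolev space with dominating mixed smoothness: for $s_1,s_2\in\mathbb{N}$ and $1\le p<\infty$, a function $f$ on $\mathbb{R}^{d_1}\times\mathbb{R}^{d_2}$ belongs to $W^{(s_1,s_2)}_p$ when $$\|f\|_{W^{(s_1,s_2)}_p}:=\sum_{|\alpha_1|\le s_1,\ |\alpha_2|\le s_2}\|\partial_2^{\alpha_2}\partial_1^{\alpha_1}f\|_p<\infty,$$ where $\alpha_i\in\mathbb{N}_0^{d_i}$ and $\partial_i^{\alpha_i}$ denotes the (weak) partial derivative of multi-index $\alpha_i$ in the variables of $\mathbb{R}^{d_i}$.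 $W^{(s_1,s_2)}_p(r)$ is the closed ball $\{f:\|f\|_{W^{(s_1,s_2)}_p}\le r\}$. An estimator $\tilde f$ is a measurable function of the sample, i.e. of $n$ i.i.d. random variables in $\mathbb{R}^{d_1}\times\mathbb{R}^{d_2}$ with density $f$; $\mathbb{E}_f$ denotes expectation when the sample is i.i.d. with density $f$. *)

theory Defs
  imports "HOL-Probability.Probability"
begin

section \<open>Test functions and weak derivatives\<close>

fun n_times_cont_diff :: "nat \<Rightarrow> ('v::euclidean_space \<Rightarrow> real) \<Rightarrow> bool" where
  "n_times_cont_diff 0 \<phi> \<longleftrightarrow> continuous_on UNIV \<phi>"
| "n_times_cont_diff (Suc k) \<phi> \<longleftrightarrow>
     (\<forall>x. \<phi> differentiable at x) \<and>
     (\<forall>v. n_times_cont_diff k (\<lambda>x. frechet_derivative \<phi> (at x) v))"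

definition test_function :: "('v::euclidean_space \<Rightarrow> real) \<Rightarrow> bool" where
  "test_function \<phi> \<longleftrightarrow> (\<forall>k. n_times_cont_diff k \<phi>) \<and> compact (closure {x. \<phi> x \<noteq> 0})"

definition dir_deriv :: "'v::euclidean_space \<Rightarrow> ('v \<Rightarrow> real) \<Rightarrow> 'v \<Rightarrow> real" where
  "dir_deriv v \<phi> = (\<lambda>x. frechet_derivative \<phi> (at x) v)"

text \<open>
  A multi-index over the finite index type \<open>'i\<close> is a function \<open>'i \<Rightarrow> nat\<close>; index \<open>i\<close> stands for
  differentiation in direction \<open>e i\<close>. The directions are processed in an arbitrary fixed order,
  which is immaterial for the smooth functions to which the operator is applied below.
\<close>

definition multi_deriv ::
  "('i::finite \<Rightarrow> 'v::euclidean_space) \<Rightarrow> ('i \<Rightarrow> nat) \<Rightarrow> ('v \<Rightarrow> real) \<Rightarrow> 'v \<Rightarrow> real" where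
  "multi_deriv e \<alpha> \<phi> =
     foldr (\<lambda>i. dir_deriv (e i) ^^ \<alpha> i) (SOME xs. distinct xs \<and> set xs = UNIV) \<phi>"

definition order_of :: "('i::finite \<Rightarrow> nat) \<Rightarrow> nat" where
  "order_of \<alpha> = (\<Sum>i\<in>UNIV. \<alpha> i)"

definition locally_integrable :: "('v::euclidean_space \<Rightarrow> real) \<Rightarrow> bool" where
  "locally_integrable f \<longleftrightarrow>
     f \<in> borel_measurable borel \<and> (\<forall>K. compact K \<longrightarrow> set_integrable lborel K f)"

definition has_weak_deriv ::
  "('i::finite \<Rightarrow> 'v::euclidean_space) \<Rightarrow> ('i \<Rightarrow> nat) \<Rightarrow> ('v \<Rightarrow> real) \<Rightarrow> ('v \<Rightarrow> real) \<Rightarrow> bool" where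
  "has_weak_deriv e \<alpha> f g \<longleftrightarrow>
     locally_integrable f \<and> locally_integrable g \<and>
     (\<forall>\<phi>. test_function \<phi> \<longrightarrow>
        (LINT x|lborel. f x * multi_deriv e \<alpha> \<phi> x) =
        (-1) ^ order_of \<alpha> * (LINT x|lborel. g x * \<phi> x))"

text \<open>Weak derivatives are unique only almost everywhere, so this picks a representative.\<close>

definition weak_deriv ::
  "('i::finite \<Rightarrow> 'v::euclidean_space) \<Rightarrow> ('i \<Rightarrow> nat) \<Rightarrow> ('v \<Rightarrow> real) \<Rightarrow> 'v \<Rightarrow> real" where
  "weak_deriv e \<alpha> f = (SOME g. has_weak_deriv e \<alpha> f g)"


section \<open>Sobolev spaces with dominating mixed smoothness\<close>

definition Lp_space :: "real \<Rightarrow> ('v::euclidean_space \<Rightarrow> real) set" where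
  "Lp_space p = {g. g \<in> borel_measurable borel \<and> integrable lborel (\<lambda>x. \<bar>g x\<bar> powr p)}"

definition Lp_norm :: "real \<Rightarrow> ('v::euclidean_space \<Rightarrow> real) \<Rightarrow> real" where
  "Lp_norm p g = (LINT x|lborel. \<bar>g x\<bar> powr p) powr (1 / p)"

definition dir1 :: "'d1::finite \<Rightarrow> (real ^ 'd1) \<times> (real ^ 'd2::finite)" where
  "dir1 i = (axis i 1, 0)"

definition dir2 :: "'d2::finite \<Rightarrow> (real ^ 'd1::finite) \<times> (real ^ 'd2)" where
  "dir2 j = (0, axis j 1)"

definition mixed_sobolev_space ::
  "nat \<Rightarrow> nat \<Rightarrow> real \<Rightarrow> ((real ^ 'd1::finite) \<times> (real ^ 'd2::finite) \<Rightarrow> real) set" where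
  "mixed_sobolev_space s1 s2 p =
     {f. \<forall>\<alpha>1 \<alpha>2. order_of \<alpha>1 \<le> s1 \<longrightarrow> order_of \<alpha>2 \<le> s2 \<longrightarrow>
           (\<exists>g. has_weak_deriv dir1 \<alpha>1 f g) \<and>
           (\<exists>h. has_weak_deriv dir2 \<alpha>2 (weak_deriv dir1 \<alpha>1 f) h) \<and>
           weak_deriv dir2 \<alpha>2 (weak_deriv dir1 \<alpha>1 f) \<in> Lp_space p}"

definition mixed_sobolev_norm ::
  "nat \<Rightarrow> nat \<Rightarrow> real \<Rightarrow> ((real ^ 'd1::finite) \<times> (real ^ 'd2::finite) \<Rightarrow> real) \<Rightarrow> real" where
  "mixed_sobolev_norm s1 s2 p f =
     (\<Sum>\<alpha>1 | order_of \<alpha>1 \<le> s1. \<Sum>\<alpha>2 | order_of \<alpha>2 \<le> s2.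
        Lp_norm p (weak_deriv dir2 \<alpha>2 (weak_deriv dir1 \<alpha>1 f)))"

definition mixed_sobolev_ball ::
  "nat \<Rightarrow> nat \<Rightarrow> real \<Rightarrow> real \<Rightarrow> ((real ^ 'd1::finite) \<times> (real ^ 'd2::finite) \<Rightarrow> real) set" where
  "mixed_sobolev_ball s1 s2 p r =
     {f \<in> mixed_sobolev_space s1 s2 p. mixed_sobolev_norm s1 s2 p f \<le> r}"


section \<open>Density estimation from an i.i.d. sample\<close>

definition prob_density :: "('v::euclidean_space \<Rightarrow> real) \<Rightarrow> bool" where
  "prob_density f \<longleftrightarrow>
     f \<in> borel_measurable borel \<and> (\<forall>x. 0 \<le> f x) \<and> (\<integral>\<^sup>+ x. ennreal (f x) \<partial>lborel) = 1"

definition iid_sample :: "nat \<Rightarrow> ('v::euclidean_space \<Rightarrow> real) \<Rightarrow> (nat \<Rightarrow> 'v) measure" where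
  "iid_sample n f = PiM {..<n} (\<lambda>_. density lborel (\<lambda>x. ennreal (f x)))"

text \<open>
  The estimate \<open>T \<omega>\<close> is a function on the whole space, so measurability of the estimator is joint
  measurability in the sample \<open>\<omega>\<close> and the evaluation point.
\<close>

definition estimators :: "nat \<Rightarrow> ((nat \<Rightarrow> 'v::euclidean_space) \<Rightarrow> 'v \<Rightarrow> real) set" where
  "estimators n =
     {T. (\<lambda>(\<omega>, x). T \<omega> x) \<in> borel_measurable (PiM {..<n} (\<lambda>_. borel) \<Otimes>\<^sub>M borel)}"

text \<open>
  The expected \<open>p\<close>-th power of the \<open>L\<^sup>p\<close> distance; it is \<open>\<infinity>\<close> when the expectation diverges,
  in particular if the estimate fails to be in \<open>L\<^sup>p\<close> with positive probability.
\<close>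

definition Lp_risk ::
  "real \<Rightarrow> nat \<Rightarrow> ((nat \<Rightarrow> 'v::euclidean_space) \<Rightarrow> 'v \<Rightarrow> real) \<Rightarrow> ('v \<Rightarrow> real) \<Rightarrow> ennreal" where
  "Lp_risk p n T f =
     (\<integral>\<^sup>+ \<omega>. (\<integral>\<^sup>+ x. ennreal (\<bar>T \<omega> x - f x\<bar> powr p) \<partial>lborel) \<partial>iid_sample n f)"

definition minimax_risk ::
  "real \<Rightarrow> nat \<Rightarrow> ('v::euclidean_space \<Rightarrow> real) set \<Rightarrow> ennreal" where
  "minimax_risk p n F = (INF T\<in>estimators n. SUP f\<in>{f \<in> F. prob_density f}. Lp_risk p n T f)"

end

theory Submission
  imports Defs
begin

text \<open>
  Put one bump of mass \<open>1/n\<close> into each of \<open>n\<close> disjoint cells, in one of two possible positions. With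
  probability \<open>(1 - 1/n)^n \<ge> 1/4\<close> the sample misses a given cell, and then it carries no information on
  the position of the bump there. Averaging over all \<open>2^n\<close> choices of positions, every estimator
  therefore loses in each cell a fixed fraction of the \<open>p\<close>-th power of the \<open>L\<^sup>p\<close> norm of a bump. For
  bumps of width \<open>1/l\<close> this gives a risk of order \<open>n powr (1 - p) * l powr (D * (p - 1))\<close>, and \<open>l\<close> may be
  taken as large as the constraint \<open>n powr (1/p - 1) * l powr (S + D - D/p) \<le> const * r\<close> imposed by
  the Sobolev ball allows. For \<open>p = 1\<close> the mass alone contributes 1 to the Sobolev norm, so only
  \<open>r - 1\<close> is left for the derivatives, and \<open>l\<close> has to be small instead, uniformly in \<open>n\<close>.
\<close>

section \<open>Smooth functions\<close>

text \<open>The domain is the whole space, so the number of cells and the width of the bumps can be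
  chosen independently, and a density can consist of bumps alone. Since the supports are disjoint,
  p-th powers of norms add up exactly. For \<open>p > 1\<close> the parameter \<open>l\<close>
  eventually exceeds 1, so the derivatives of top order \<open>S\<close> dominate the Sobolev norm;
  solving for \<open>l\<close> produces the power \<open>p / K\<close> with
  \<open>K = S * p + D * (p - 1)\<close>, the denominator of the rate. The powers of
  \<open>r\<close> and \<open>n\<close> in the resulting risk then cancel against the rate, which is
  why the constant does not depend on \<open>r\<close>. For \<open>p = 1\<close> the rate exponent
  is 0 and the risk bound does not involve \<open>l\<close> at all.

  The obstacle is to compute the Sobolev norm of these densities. \<open>weak_deriv\<close> is an
  unspecified representative, and the outer weak derivative is applied to the representative chosen
  by the inner one. Both must be identified almost everywhere with classical derivatives. This
  requires uniqueness of weak derivatives, hence integration by parts and enough explicit test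
  functions to determine a locally integrable function almost everywhere.\<close>

lemma n_times_cont_diff_SucD: "n_times_cont_diff (Suc k) f \<Longrightarrow> n_times_cont_diff k f"
proof (induction k arbitrary: f)
  case 0
  then show ?case
    by (auto intro!: differentiable_imp_continuous_on simp: differentiable_on_def
        intro: differentiable_at_withinI)
next
  case (Suc k)
  then show ?case by (metis n_times_cont_diff.simps(2))
qed

lemma n_times_cont_diff_has_derivative:
  "n_times_cont_diff (Suc k) f \<Longrightarrow> (f has_derivative frechet_derivative f (at x)) (at x)"
  using frechet_derivative_works by auto

text \<open>By uniqueness of derivatives any explicit formula may replace
  \<open>frechet_derivative\<close>. All closure properties below are inductions through this
  rule.\<close>

lemma n_times_cont_diff_SucI:
  assumes "\<And>x. (f has_derivative f' x) (at x)" and "\<And>v. n_times_cont_diff k (\<lambda>x. f' x v)"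
  shows "n_times_cont_diff (Suc k) f"
proof -
  have "frechet_derivative f (at x) = f' x" for x
    using frechet_derivative_at[OF assms(1)] by simp
  then show ?thesis
    using assms by (auto simp: differentiable_def)
qed

lemma n_times_cont_diff_const: "n_times_cont_diff k (\<lambda>x. c)"
proof (induction k arbitrary: c)
  case (Suc k)
  show ?case by (rule n_times_cont_diff_SucI[OF has_derivative_const Suc])
qed auto

lemma n_times_cont_diff_inner: "n_times_cont_diff k (\<lambda>x. x \<bullet> b)"
proof (cases k)
  case (Suc k')
  have "((\<lambda>x. x \<bullet> b) has_derivative (\<lambda>v. v \<bullet> b)) (at x)" for x
    by (auto intro!: derivative_eq_intros)
  from n_times_cont_diff_SucI[OF this n_times_cont_diff_const] Suc show ?thesis by simp
qed (auto intro!: continuous_intros)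

lemma n_times_cont_diff_add:
  "n_times_cont_diff k f \<Longrightarrow> n_times_cont_diff k g \<Longrightarrow> n_times_cont_diff k (\<lambda>x. f x + g x)"
proof (induction k arbitrary: f g)
  case (Suc k)
  show ?case
    by (rule n_times_cont_diff_SucI[OF has_derivative_add[OF
              Suc.prems[THEN n_times_cont_diff_has_derivative]]])
      (use Suc in auto)
qed (auto intro: continuous_on_add)

text \<open>The product rule leaves one factor undifferentiated, so the induction also needs
  \<open>f\<close> and \<open>g\<close> themselves at the lower order, which
  \<open>n_times_cont_diff_SucD\<close> supplies.\<close>

lemma n_times_cont_diff_mult:
  "n_times_cont_diff k f \<Longrightarrow> n_times_cont_diff k g \<Longrightarrow> n_times_cont_diff k (\<lambda>x. f x * g x)"
proof (induction k arbitrary: f g)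
  case (Suc k)
  show ?case
    by (rule n_times_cont_diff_SucI[OF has_derivative_mult[OF
              Suc.prems[THEN n_times_cont_diff_has_derivative]]])
      (use Suc Suc.prems[THEN n_times_cont_diff_SucD] in \<open>auto intro!: n_times_cont_diff_add\<close>)
qed (auto intro: continuous_on_mult)

lemma has_derivative_scaleR_shift:
  assumes "(f has_derivative f') (at (c *\<^sub>R (x - a)))"
  shows "((\<lambda>x. f (c *\<^sub>R (x - a))) has_derivative (\<lambda>v. f' (c *\<^sub>R v))) (at x)"
  by (rule has_derivative_compose[of "\<lambda>x. c *\<^sub>R (x - a)" "\<lambda>v. c *\<^sub>R v", OF _ assms])
    (auto intro!: derivative_eq_intros)

lemma n_times_cont_diff_scaleR_shift:
  "n_times_cont_diff k f \<Longrightarrow> n_times_cont_diff k (\<lambda>x. f (c *\<^sub>R (x - a)))"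
proof (induction k arbitrary: f)
  case 0
  then have "continuous_on UNIV f" by simp
  then have "continuous_on UNIV (\<lambda>x. f (c *\<^sub>R (x - a)))"
    by (rule continuous_on_compose2) (intro continuous_intros, simp)
  then show ?case by simp
next
  case (Suc k)
  show ?case
    by (rule n_times_cont_diff_SucI[OF has_derivative_scaleR_shift[OF
              Suc.prems[THEN n_times_cont_diff_has_derivative]]])
      (use Suc in auto)
qed

section \<open>Smooth cutoffs\<close>

text \<open>The parameter \<open>m\<close> makes the family closed under differentiation, up to linear combinations.\<close>

definition exp_flat :: "nat \<Rightarrow> real \<Rightarrow> real" where
  "exp_flat m t = (if t > 0 then (1 / t) ^ m * exp (- (1 / t)) else 0)"

lemma exp_flat_has_derivative:
  "(exp_flat m has_real_derivative exp_flat (m + 2) t - real m * exp_flat (m + 1) t) (at t)"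
proof -
  consider "t > 0" | "t < 0" | "t = 0" by linarith
  then show ?thesis
  proof cases
    case 1
    have inv: "((\<lambda>t. 1 / t) has_real_derivative - ((1 / t) * (1 / t))) (at t)"
      using 1 by (auto intro!: derivative_eq_intros simp: divide_inverse)
    have "((\<lambda>t. (1 / t) ^ m) has_real_derivative - real m * (1 / t) ^ (m + 1)) (at t)"
      by (rule DERIV_cong[OF DERIV_power[OF inv]]) (cases m, auto simp: divide_inverse algebra_simps)
    from DERIV_mult[OF this DERIV_fun_exp[OF DERIV_minus[OF inv]]]
    have "((\<lambda>t. (1 / t) ^ m * exp (- (1 / t))) has_real_derivative
        exp_flat (m + 2) t - real m * exp_flat (m + 1) t) (at t)"
      by (rule DERIV_cong) (use 1 in \<open>auto simp: exp_flat_def divide_inverse algebra_simps\<close>)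
    then show ?thesis
      by (rule has_field_derivative_transform_within_open[where S = "{0<..}"])
        (use 1 in \<open>auto simp: exp_flat_def\<close>)
  next
    case 2
    have "((\<lambda>t. 0) has_real_derivative exp_flat (m + 2) t - real m * exp_flat (m + 1) t) (at t)"
      using 2 by (auto simp: exp_flat_def)
    then show ?thesis
      by (rule has_field_derivative_transform_within_open[where S = "{..<0}"])
        (use 2 in \<open>auto simp: exp_flat_def\<close>)
  next
    case 3
    \<comment> \<open>With \<open>u = 1 / t\<close> the right difference quotient at 0 becomes
      \<open>u ^ (m + 1) / exp u\<close>, and the exponential wins. On the left the quotient is
      identically 0.\<close>
    have "((\<lambda>u::real. u ^ (m + 1) / exp u) \<longlongrightarrow> 0) at_top"
      by (rule tendsto_power_div_exp_0)
    then have "((\<lambda>t. inverse t ^ (m + 1) / exp (inverse t)) \<longlongrightarrow> 0) (at_right (0::real))"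
      by (rule filterlim_compose[OF _ filterlim_inverse_at_top_right])
    moreover have "\<forall>\<^sub>F t in at_right 0. inverse t ^ (m + 1) / exp (inverse t) = exp_flat m t / t"
      by (auto simp: eventually_at_filter exp_flat_def field_simps exp_minus)
    ultimately have "((\<lambda>t. exp_flat m t / t) \<longlongrightarrow> 0) (at_right 0)"
      by (rule Lim_transform_eventually)
    moreover have "((\<lambda>t. exp_flat m t / t) \<longlongrightarrow> 0) (at_left 0)"
      by (rule Lim_transform_eventually[OF tendsto_const])
        (auto simp: eventually_at_filter exp_flat_def)
    ultimately have "((\<lambda>t. exp_flat m t / t) \<longlongrightarrow> 0) (at 0)"
      by (simp add: filterlim_split_at)
    then show ?thesis
      using 3 by (simp add: DERIV_def exp_flat_def)
  qed
qed

lemma exp_flat_has_derivative_compose: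
  fixes f :: "'v::euclidean_space \<Rightarrow> real"
  assumes "(f has_derivative f') (at x)"
  shows "((\<lambda>x. exp_flat m (f x)) has_derivative
    (\<lambda>v. (exp_flat (m + 2) (f x) + (- real m) * exp_flat (m + 1) (f x)) * f' v)) (at x)"
  using has_derivative_compose[OF assms, of "exp_flat m"] exp_flat_has_derivative[of m "f x"]
  by (auto simp: has_field_derivative_def)

lemma n_times_cont_diff_exp_flat:
  "n_times_cont_diff k f \<Longrightarrow> n_times_cont_diff k (\<lambda>x. exp_flat m (f x))"
proof (induction k arbitrary: m)
  case 0
  have "continuous_on UNIV (exp_flat m)"
    by (rule DERIV_continuous_on) (rule has_field_derivative_at_within[OF exp_flat_has_derivative])
  from continuous_on_compose2[OF this] 0 show ?case by simp
next
  case (Suc k)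
  have "n_times_cont_diff k (\<lambda>x. exp_flat m (f x))" for m
    using Suc.IH n_times_cont_diff_SucD[OF Suc.prems] by blast
  then show ?case
    by (intro n_times_cont_diff_SucI[OF exp_flat_has_derivative_compose[OF
              n_times_cont_diff_has_derivative[OF Suc.prems]]]
          n_times_cont_diff_mult n_times_cont_diff_add n_times_cont_diff_const)
      (use Suc.prems in auto)
qed

lemma n_times_cont_diff_prod:
  "(\<And>i. i \<in> I \<Longrightarrow> n_times_cont_diff k (f i)) \<Longrightarrow> n_times_cont_diff k (\<lambda>x. \<Prod>i\<in>I. f i x)"
  by (induction I rule: infinite_finite_induct)
    (auto intro!: n_times_cont_diff_const n_times_cont_diff_mult)

text \<open>A smooth minorant of the indicator of the open box. The factor \<open>k\<close>
  stretches the distances to the faces: as it grows, the values inside tend to 1 while the support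
  stays in the closed box. The family serves both as approximate indicators for the uniqueness of
  weak derivatives and, with \<open>k = 1\<close>, as the profile of the bumps.\<close>

definition box_bump :: "real \<Rightarrow> 'v::euclidean_space \<Rightarrow> 'v \<Rightarrow> 'v \<Rightarrow> real" where
  "box_bump k a b x = (\<Prod>i\<in>Basis. exp_flat 0 (k * (x \<bullet> i - a \<bullet> i)) * exp_flat 0 (k * (b \<bullet> i - x \<bullet> i)))"

lemma exp_flat_0_bounds: "0 \<le> exp_flat 0 t" "exp_flat 0 t \<le> 1" "exp_flat 0 t > 0 \<longleftrightarrow> t > 0"
  by (auto simp: exp_flat_def)

lemma box_bump_nonneg: "0 \<le> box_bump k a b x"
  by (auto simp: box_bump_def intro!: prod_nonneg mult_nonneg_nonneg exp_flat_0_bounds)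

lemma box_bump_le_1: "box_bump k a b x \<le> 1"
  unfolding box_bump_def by (intro prod_le_1 conjI mult_nonneg_nonneg mult_le_one exp_flat_0_bounds)

lemma box_bump_pos: "k > 0 \<Longrightarrow> x \<in> box a b \<Longrightarrow> box_bump k a b x > 0"
  unfolding box_bump_def by (intro prod_pos ballI mult_pos_pos)
    (auto simp: exp_flat_0_bounds mem_box)

lemma box_bump_eq_0:
  assumes "k > 0" "x \<notin> box a b"
  shows "box_bump k a b x = 0"
proof -
  from assms(2) obtain i where "i \<in> Basis" "x \<bullet> i \<le> a \<bullet> i \<or> b \<bullet> i \<le> x \<bullet> i"
    by (auto simp: mem_box not_less)
  then show ?thesis
    using assms(1) unfolding box_bump_def
    by (intro prod_zero bexI[of _ i]) (auto simp: exp_flat_def zero_less_mult_iff)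
qed

lemma test_function_box_bump:
  assumes "k > 0"
  shows "test_function (box_bump k a b)"
proof -
  have "n_times_cont_diff m (box_bump k a b)" for m
  proof -
    have "n_times_cont_diff m (\<lambda>x. exp_flat 0 (k * (x \<bullet> i + - (a \<bullet> i))) * exp_flat 0 (k * (b \<bullet> i + (- 1) * (x \<bullet> i))))" for i
      by (intro n_times_cont_diff_mult n_times_cont_diff_exp_flat n_times_cont_diff_add
          n_times_cont_diff_const n_times_cont_diff_inner)
    then show ?thesis
      unfolding box_bump_def by (intro n_times_cont_diff_prod) simp
  qed
  moreover have "bounded {x. box_bump k a b x \<noteq> 0}"
    using box_bump_eq_0[OF assms] by (intro bounded_subset[OF bounded_box[of a b]]) auto
  ultimately show ?thesis
    by (simp add: test_function_def compact_closure)
qed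

lemma exp_flat_0_tendsto: "(\<lambda>k. exp_flat 0 (real (Suc k) * t)) \<longlonglongrightarrow> (if t > 0 then 1 else 0)"
proof (cases "t > 0")
  case True
  have "(\<lambda>k. exp (- (inverse (real (Suc k)) * (1 / t)))) \<longlonglongrightarrow> exp (- (0 * (1 / t)))"
    by (intro tendsto_intros LIMSEQ_inverse_real_of_nat)
  moreover have "exp_flat 0 (real (Suc k) * t) = exp (- (inverse (real (Suc k)) * (1 / t)))" for k
    using True by (simp add: exp_flat_def inverse_eq_divide)
  ultimately show ?thesis using True by simp
next
  case False
  then have "exp_flat 0 (real (Suc k) * t) = 0" for k
    by (simp add: exp_flat_def zero_less_mult_iff)
  then show ?thesis using False by simp
qed

lemma box_bump_tendsto: "(\<lambda>k. box_bump (real (Suc k)) a b x) \<longlonglongrightarrow> indicat_real (box a b) x"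
proof (cases "x \<in> box a b")
  case True
  have lim: "(\<lambda>k. box_bump (real (Suc k)) a b x) \<longlonglongrightarrow>
      (\<Prod>i\<in>Basis. (if x \<bullet> i - a \<bullet> i > 0 then 1 else 0) * (if b \<bullet> i - x \<bullet> i > 0 then 1 else 0))"
    unfolding box_bump_def by (intro tendsto_prod tendsto_mult exp_flat_0_tendsto)
  have "(\<Prod>i\<in>Basis. (if x \<bullet> i - a \<bullet> i > 0 then 1 else 0) *
      (if b \<bullet> i - x \<bullet> i > 0 then 1 else 0)) = indicat_real (box a b) x"
    using True by (auto simp: mem_box intro!: prod.neutral)
  with lim show ?thesis by simp
next
  case False
  then show ?thesis by (simp add: box_bump_eq_0)
qed

section \<open>Weak derivatives of test functions\<close>

definition smooth :: "('v::euclidean_space \<Rightarrow> real) \<Rightarrow> bool" where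
  "smooth f \<longleftrightarrow> (\<forall>k. n_times_cont_diff k f)"

lemma smooth_has_derivative: "smooth f \<Longrightarrow> (f has_derivative (\<lambda>v. dir_deriv v f x)) (at x)"
  unfolding smooth_def dir_deriv_def using n_times_cont_diff_has_derivative by blast

lemma smooth_dir_deriv: "smooth f \<Longrightarrow> smooth (dir_deriv v f)"
  unfolding smooth_def dir_deriv_def using n_times_cont_diff.simps(2) by blast

lemma smooth_continuous: "smooth f \<Longrightarrow> continuous_on UNIV f"
  unfolding smooth_def using n_times_cont_diff.simps(1) by blast

lemma smooth_borel_measurable: "smooth f \<Longrightarrow> f \<in> borel_measurable borel"
  by (intro borel_measurable_continuous_onI smooth_continuous)

lemma smooth_const: "smooth (\<lambda>x. c)"
  by (simp add: smooth_def n_times_cont_diff_const)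

lemma smooth_add: "smooth f \<Longrightarrow> smooth g \<Longrightarrow> smooth (\<lambda>x. f x + g x)"
  by (simp add: smooth_def n_times_cont_diff_add)

lemma smooth_mult: "smooth f \<Longrightarrow> smooth g \<Longrightarrow> smooth (\<lambda>x. f x * g x)"
  by (simp add: smooth_def n_times_cont_diff_mult)

lemma smooth_scaleR_shift: "smooth f \<Longrightarrow> smooth (\<lambda>x. f (c *\<^sub>R (x - a)))"
  by (simp add: smooth_def n_times_cont_diff_scaleR_shift)

lemma dir_deriv_eqI: "(f has_derivative f') (at x) \<Longrightarrow> dir_deriv v f x = f' v"
  unfolding dir_deriv_def using frechet_derivative_at by metis

lemma dir_deriv_mult:
  "smooth f \<Longrightarrow> smooth g \<Longrightarrow>
    dir_deriv v (\<lambda>x. f x * g x) x = f x * dir_deriv v g x + dir_deriv v f x * g x"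
  by (intro dir_deriv_eqI has_derivative_mult smooth_has_derivative)

lemma dir_deriv_sum:
  assumes "\<And>i. i \<in> I \<Longrightarrow> smooth (f i)"
  shows "dir_deriv v (\<lambda>x. \<Sum>i\<in>I. f i x) = (\<lambda>x. \<Sum>i\<in>I. dir_deriv v (f i) x)"
  by (intro ext dir_deriv_eqI has_derivative_sum smooth_has_derivative assms)

lemma dir_deriv_cmult:
  "smooth f \<Longrightarrow> dir_deriv v (\<lambda>x. c * f x) = (\<lambda>x. c * dir_deriv v f x)"
  by (intro ext dir_deriv_eqI has_derivative_mult_right smooth_has_derivative)

lemma dir_deriv_scaleR_shift:
  assumes "smooth f"
  shows "dir_deriv v (\<lambda>x. f (c *\<^sub>R (x - a))) = (\<lambda>x. c * dir_deriv v f (c *\<^sub>R (x - a)))"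
proof
  fix x
  note D = smooth_has_derivative[OF assms, of "c *\<^sub>R (x - a)"]
  have "dir_deriv v (\<lambda>x. f (c *\<^sub>R (x - a))) x = dir_deriv (c *\<^sub>R v) f (c *\<^sub>R (x - a))"
    by (rule dir_deriv_eqI[OF has_derivative_scaleR_shift[OF D]])
  also have "\<dots> = c * dir_deriv v f (c *\<^sub>R (x - a))"
    using linear_scale[OF has_derivative_linear[OF D]] by simp
  finally show "dir_deriv v (\<lambda>x. f (c *\<^sub>R (x - a))) x = c * dir_deriv v f (c *\<^sub>R (x - a))" .
qed

lemma dir_deriv_eq_0_outside:
  assumes "open U" "\<And>y. y \<in> U \<Longrightarrow> f y = 0" "x \<in> U"
  shows "dir_deriv v f x = 0"
proof -
  have "(f has_derivative (\<lambda>v. 0)) (at x)"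
    by (rule has_derivative_transform_within_open[OF has_derivative_const[of 0] assms(1,3)])
      (use assms(2) in simp)
  then show ?thesis by (rule dir_deriv_eqI)
qed

lemma test_function_iff: "test_function f \<longleftrightarrow> smooth f \<and> bounded {x. f x \<noteq> 0}"
  by (simp add: test_function_def smooth_def compact_closure)

text \<open>Off the closure \<open>f\<close> is locally 0. The closure cannot be dropped, since
  \<open>f\<close> may cross 0 with nonzero slope.\<close>

lemma dir_deriv_support: "{x. dir_deriv v f x \<noteq> 0} \<subseteq> closure {x. f x \<noteq> 0}"
proof (rule subsetI, rule ccontr)
  fix x assume x: "x \<in> {x. dir_deriv v f x \<noteq> 0}" "x \<notin> closure {x. f x \<noteq> 0}"
  have "dir_deriv v f x = 0"
  proof (rule dir_deriv_eq_0_outside)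
    show "f y = 0" if "y \<in> - closure {x. f x \<noteq> 0}" for y
      using that closure_subset[of "{x. f x \<noteq> 0}"] by (metis (mono_tags) ComplD mem_Collect_eq subsetD)
  qed (use x(2) in \<open>simp_all add: open_Compl\<close>)
  with x(1) show False by simp
qed

lemma test_function_dir_deriv: "test_function f \<Longrightarrow> test_function (dir_deriv v f)"
  unfolding test_function_iff
  by (auto intro: smooth_dir_deriv bounded_subset[OF _ dir_deriv_support])

lemma test_function_mult: "test_function f \<Longrightarrow> smooth g \<Longrightarrow> test_function (\<lambda>x. f x * g x)"
  unfolding test_function_iff by (auto intro: smooth_mult elim: bounded_subset)

lemma test_function_bound:
  assumes "test_function f"
  obtains B where "B \<ge> 0" "\<And>x. \<bar>f x\<bar> \<le> B"
proof -
  let ?K = "closure {x. f x \<noteq> 0}"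
  have "continuous_on ?K f"
    using assms by (auto simp: test_function_iff intro: continuous_on_subset smooth_continuous)
  moreover have "compact ?K"
    using assms by (simp add: test_function_def)
  ultimately have "bounded (f ` ?K)"
    by (intro compact_imp_bounded compact_continuous_image)
  then obtain B where B: "B > 0" "\<And>y. y \<in> f ` ?K \<Longrightarrow> norm y \<le> B"
    unfolding bounded_pos by auto
  have "\<bar>f x\<bar> \<le> B" for x
  proof (cases "f x = 0")
    case False
    then have "x \<in> ?K" using closure_subset[of "{x. f x \<noteq> 0}"] by auto
    then show ?thesis using B(2)[of "f x"] by simp
  qed (use B(1) in auto)
  with B(1) show ?thesis by (intro that[of B]) auto
qed

lemma test_function_integrable:
  assumes "test_function f"
  shows "integrable lborel f"
proof -
  let ?K = "closure {x. f x \<noteq> 0}"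
  have "integrable lborel (\<lambda>x. indicator ?K x *\<^sub>R f x)"
    using assms by (intro borel_integrable_compact)
      (auto simp: test_function_iff compact_closure intro: continuous_on_subset smooth_continuous)
  also have "(\<lambda>x. indicator ?K x *\<^sub>R f x) = f"
    using closure_subset[of "{x. f x \<noteq> 0}"] by (auto simp: fun_eq_iff indicator_def)
  finally show ?thesis .
qed

section \<open>Integration by parts for test functions\<close>

lemma integral_lborel_translate:
  fixes f :: "'v::euclidean_space \<Rightarrow> real"
  assumes [measurable]: "f \<in> borel_measurable borel"
  shows "(LINT x|lborel. f (x + a)) = (LINT x|lborel. f x)"
proof -
  have "(LINT x|lborel. f x) = (LINT x|distr lborel borel ((+) a). f x)"
    by (simp only: lborel_distr_plus)
  also have "\<dots> = (LINT x|lborel. f (x + a))"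
    by (subst integral_distr) (auto simp: add.commute)
  finally show ?thesis by simp
qed

text \<open>Difference quotients have integral zero by translation invariance; pass to the limit.\<close>

lemma integral_dir_deriv_eq_0:
  fixes f :: "'v::euclidean_space \<Rightarrow> real"
  assumes f: "test_function f"
  shows "(LINT x|lborel. dir_deriv v f x) = 0"
proof -
  have sm: "smooth f" and bd: "bounded {x. f x \<noteq> 0}"
    using f by (auto simp: test_function_iff)
  note [measurable] = smooth_borel_measurable[OF sm] smooth_borel_measurable[OF smooth_dir_deriv[OF sm]]
  obtain B where B: "B \<ge> 0" "\<And>x. \<bar>dir_deriv v f x\<bar> \<le> B"
    using test_function_bound[OF test_function_dir_deriv[OF f, of v]] by blast
  obtain R where R: "\<And>x. f x \<noteq> 0 \<Longrightarrow> norm x \<le> R"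
    using bd unfolding bounded_iff by auto
  define q where "q k x = real (Suc k) * (f (x + inverse (real (Suc k)) *\<^sub>R v) - f x)" for k x
  have line: "((\<lambda>t. f (x + t *\<^sub>R v)) has_real_derivative dir_deriv v f (x + t *\<^sub>R v)) (at t)" for x t
  proof -
    note D = smooth_has_derivative[OF sm, of "x + t *\<^sub>R v"]
    have "((\<lambda>t. f (x + t *\<^sub>R v)) has_derivative (\<lambda>s. dir_deriv (s *\<^sub>R v) f (x + t *\<^sub>R v))) (at t)"
      by (rule has_derivative_compose[where f = "\<lambda>t. x + t *\<^sub>R v" and f' = "\<lambda>s. s *\<^sub>R v", OF _ D])
        (auto intro!: derivative_eq_intros)
    moreover have "dir_deriv (s *\<^sub>R v) f (x + t *\<^sub>R v) = dir_deriv v f (x + t *\<^sub>R v) * s" for s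
      using linear_scale[OF has_derivative_linear[OF D]] by simp
    ultimately show ?thesis by (simp add: has_field_derivative_def)
  qed
  have "(\<lambda>k. LINT x|lborel. q k x) \<longlonglongrightarrow> (LINT x|lborel. dir_deriv v f x)"
  proof (rule integral_dominated_convergence)
    \<comment> \<open>Domination: by the mean value theorem the quotient is a value of the
      directional derivative, hence at most \<open>B\<close>. As the step is at most 1, the quotient
      vanishes outside the ball of radius \<open>R + norm v\<close>.\<close>
    show "integrable lborel (\<lambda>x. B * indicator (cball 0 (R + norm v)) x)"
      by (intro integrable_mult_right integrable_real_indicator emeasure_bounded_finite) auto
    show "AE x in lborel. (\<lambda>k. q k x) \<longlonglongrightarrow> dir_deriv v f x"
    proof (rule AE_I2)
      fix x
      have "((\<lambda>t. (f (x + t *\<^sub>R v) - f x) / t) \<longlongrightarrow> dir_deriv v f x) (at 0)"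
        using line[of x 0] by (simp add: DERIV_def)
      moreover have "filterlim (\<lambda>k. inverse (real (Suc k))) (at 0) sequentially"
        by (simp add: filterlim_at LIMSEQ_inverse_real_of_nat del: of_nat_Suc)
      ultimately have "(\<lambda>k. (f (x + inverse (real (Suc k)) *\<^sub>R v) - f x) / inverse (real (Suc k)))
          \<longlonglongrightarrow> dir_deriv v f x"
        by (rule filterlim_compose)
      then show "(\<lambda>k. q k x) \<longlonglongrightarrow> dir_deriv v f x"
        by (simp add: q_def field_simps del: of_nat_Suc)
    qed
    show "AE x in lborel. norm (q k x) \<le> B * indicator (cball 0 (R + norm v)) x" for k
    proof (rule AE_I2)
      fix x
      let ?t = "inverse (real (Suc k))"
      have t: "?t > 0" "?t \<le> 1" by (auto simp: field_simps)
      obtain z where z: "f (x + ?t *\<^sub>R v) - f (x + 0 *\<^sub>R v) = (?t - 0) * dir_deriv v f (x + z *\<^sub>R v)"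
        using MVT2[OF t(1), of "\<lambda>t. f (x + t *\<^sub>R v)" "\<lambda>t. dir_deriv v f (x + t *\<^sub>R v)"] line by blast
      then have eq: "q k x = dir_deriv v f (x + z *\<^sub>R v)"
        by (simp add: q_def del: of_nat_Suc)
      have "q k x = 0" if "x \<notin> cball 0 (R + norm v)"
      proof -
        have nx: "norm x > R + norm v" using that by simp
        have "norm x \<le> norm (x + ?t *\<^sub>R v) + norm (?t *\<^sub>R v)"
          using norm_triangle_ineq4[of "x + ?t *\<^sub>R v" "?t *\<^sub>R v"] by simp
        moreover have "norm (?t *\<^sub>R v) \<le> norm v"
          using mult_right_mono[OF t(2) norm_ge_zero[of v]] t(1) by simp
        ultimately have "norm (x + ?t *\<^sub>R v) > R" using nx by linarith
        moreover have "norm x > R" using nx norm_ge_zero[of v] by linarith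
        ultimately have "f (x + ?t *\<^sub>R v) = 0" "f x = 0"
          using R by force+
        then show ?thesis by (simp add: q_def)
      qed
      then show "norm (q k x) \<le> B * indicator (cball 0 (R + norm v)) x"
        using B eq by (cases "x \<in> cball 0 (R + norm v)") auto
    qed
  qed (auto simp: q_def)
  moreover have "(LINT x|lborel. q k x) = 0" for k
  proof -
    let ?a = "inverse (real (Suc k)) *\<^sub>R v"
    have int: "integrable lborel f" by (rule test_function_integrable[OF f])
    \<comment> \<open>The factor 1 and the double negation only bring the translate into the form of
      \<open>smooth_scaleR_shift\<close>.\<close>
    have "test_function (\<lambda>x. f (1 *\<^sub>R (x - (- ?a))))"
    proof -
      have "{x. f (1 *\<^sub>R (x - (- ?a))) \<noteq> 0} \<subseteq> (\<lambda>x. - ?a + x) ` {x. f x \<noteq> 0}"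
        by (auto simp: image_iff intro!: exI[of _ "_ + ?a"])
      then have "bounded {x. f (1 *\<^sub>R (x - (- ?a))) \<noteq> 0}"
        by (rule bounded_subset[OF bounded_translation[OF bd]])
      then show ?thesis
        unfolding test_function_iff using smooth_scaleR_shift[OF sm, of 1 "- ?a"] by blast
    qed
    then have "integrable lborel (\<lambda>x. f (x + ?a))"
      using test_function_integrable by force
    then show ?thesis
      using int unfolding q_def
      by (simp add: integral_lborel_translate Bochner_Integration.integral_diff del: of_nat_Suc)
  qed
  ultimately show ?thesis by (simp add: LIMSEQ_const_iff)
qed

text \<open>The derivative of the product \<open>f x * g x\<close> has integral 0, as compact
  support leaves no boundary term.\<close>

lemma integral_by_parts_dir_deriv:
  assumes "test_function f" "test_function g"
  shows "(LINT x|lborel. f x * dir_deriv v g x) = - (LINT x|lborel. dir_deriv v f x * g x)"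
proof -
  have sm: "smooth f" "smooth g" using assms by (auto simp: test_function_iff)
  have "0 = (LINT x|lborel. f x * dir_deriv v g x + dir_deriv v f x * g x)"
    using integral_dir_deriv_eq_0[OF test_function_mult[OF assms(1) sm(2)], of v]
    by (simp add: dir_deriv_mult[OF sm])
  also have "\<dots> = (LINT x|lborel. f x * dir_deriv v g x) + (LINT x|lborel. dir_deriv v f x * g x)"
    by (intro Bochner_Integration.integral_add test_function_integrable test_function_mult
        test_function_dir_deriv assms smooth_dir_deriv sm)
  finally show ?thesis by simp
qed

section \<open>Iterated derivatives and multi-indices\<close>

abbreviation iter_deriv :: "'v list \<Rightarrow> ('v::euclidean_space \<Rightarrow> real) \<Rightarrow> 'v \<Rightarrow> real" where
  "iter_deriv vs \<equiv> foldr dir_deriv vs"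

lemma test_function_iter_deriv: "test_function f \<Longrightarrow> test_function (iter_deriv vs f)"
  by (induction vs) (auto intro: test_function_dir_deriv)

lemma smooth_iter_deriv: "smooth f \<Longrightarrow> smooth (iter_deriv vs f)"
  by (induction vs) (auto intro: smooth_dir_deriv)

text \<open>In \<open>iter_deriv\<close> the head of the list is the outermost derivative. Each step
  moves the outermost derivative of \<open>g\<close> onto \<open>f\<close>, where it becomes the
  innermost one; hence the \<open>rev\<close>, and an induction with \<open>f\<close>
  arbitrary.\<close>

lemma integral_by_parts_iter_deriv:
  assumes "test_function f" "test_function g"
  shows "(LINT x|lborel. f x * iter_deriv vs g x) =
    (-1) ^ length vs * (LINT x|lborel. iter_deriv (rev vs) f x * g x)"
  using assms(1)
proof (induction vs arbitrary: f)
  case (Cons v vs)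
  have "(LINT x|lborel. f x * iter_deriv (v # vs) g x) =
      - (LINT x|lborel. dir_deriv v f x * iter_deriv vs g x)"
    using integral_by_parts_dir_deriv[OF Cons.prems test_function_iter_deriv[OF assms(2)]] by simp
  with Cons.IH[OF test_function_dir_deriv[OF Cons.prems]] show ?case by simp
qed simp

text \<open>Trades the unspecified enumeration of the indices for a list of directions. Only its
  length is recorded: that alone determines the sign in integration by parts and the power of
  \<open>l\<close> under rescaling.\<close>

lemma multi_deriv_eq_iter_deriv:
  fixes e :: "'i::finite \<Rightarrow> 'v::euclidean_space"
  obtains vs where "multi_deriv e \<alpha> = iter_deriv vs" "length vs = order_of \<alpha>"
proof -
  have fold: "foldr (\<lambda>i. dir_deriv (e i) ^^ \<alpha> i) xs \<phi> =
      iter_deriv (concat (map (\<lambda>i. replicate (\<alpha> i) (e i)) xs)) \<phi>" for xs \<phi>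
    by (induction xs) auto
  define xs :: "'i list" where "xs = (SOME xs. distinct xs \<and> set xs = UNIV)"
  have xs: "distinct xs \<and> set xs = UNIV"
    unfolding xs_def by (rule someI_ex) (metis finite_distinct_list[OF finite])
  have "length (concat (map (\<lambda>i. replicate (\<alpha> i) (e i)) xs)) = sum_list (map \<alpha> xs)"
    by (induction xs) auto
  also have "\<dots> = order_of \<alpha>"
    using xs by (auto simp: order_of_def sum_list_distinct_conv_sum_set)
  finally show ?thesis
    using fold by (intro that) (auto simp: multi_deriv_def xs_def fun_eq_iff)
qed

section \<open>Uniqueness of weak derivatives\<close>

lemma locally_integrable_mult_test_function:
  assumes "locally_integrable g" "test_function \<phi>"
  shows "integrable lborel (\<lambda>x. g x * \<phi> x)"
proof -
  let ?K = "closure {x. \<phi> x \<noteq> 0}"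
  have [measurable]: "g \<in> borel_measurable borel" "\<phi> \<in> borel_measurable borel"
    using assms by (auto simp: locally_integrable_def test_function_iff smooth_borel_measurable)
  obtain B where B: "B \<ge> 0" "\<And>x. \<bar>\<phi> x\<bar> \<le> B"
    using test_function_bound[OF assms(2)] by blast
  have "set_integrable lborel ?K g"
    using assms by (simp add: locally_integrable_def test_function_def)
  then have "integrable lborel (\<lambda>x. B * (indicator ?K x *\<^sub>R g x))"
    unfolding set_integrable_def by (rule integrable_mult_right)
  then show ?thesis
  proof (rule Bochner_Integration.integrable_bound)
    show "AE x in lborel. norm (g x * \<phi> x) \<le> norm (B * (indicator ?K x *\<^sub>R g x))"
    proof (rule AE_I2)
      fix x
      show "norm (g x * \<phi> x) \<le> norm (B * (indicator ?K x *\<^sub>R g x))"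
      proof (cases "\<phi> x = 0")
        case False
        then have "x \<in> ?K" using closure_subset[of "{x. \<phi> x \<noteq> 0}"] by auto
        then show ?thesis
          using mult_right_mono[OF B(2)[of x], of "\<bar>g x\<bar>"] B(1) by (simp add: abs_mult mult.commute)
      qed simp
    qed
  qed simp
qed

lemma test_function_locally_integrable:
  assumes "test_function f"
  shows "locally_integrable f"
  unfolding locally_integrable_def set_integrable_def
proof (intro conjI allI impI)
  show "f \<in> borel_measurable borel"
    using assms by (simp add: test_function_iff smooth_borel_measurable)
  fix K :: "'a set" assume "compact K"
  then show "integrable lborel (\<lambda>x. indicator K x *\<^sub>R f x)"
    using assms by (intro borel_integrable_compact)
      (auto simp: test_function_iff intro: continuous_on_subset smooth_continuous)
qed

text \<open>The box bumps converge to the indicator of the box, so the densities given by the positive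
  and the negative part of \<open>g\<close> agree on all boxes.\<close>

lemma AE_zero_if_orthogonal_to_test_functions:
  fixes g :: "'v::euclidean_space \<Rightarrow> real"
  assumes g: "locally_integrable g"
    and orth: "\<And>\<phi>. test_function \<phi> \<Longrightarrow> (LINT x|lborel. g x * \<phi> x) = 0"
  shows "AE x in lborel. g x = 0"
proof -
  have [measurable]: "g \<in> borel_measurable borel"
    using g by (simp add: locally_integrable_def)
  have box_int: "integrable lborel (\<lambda>x. g x * indicator (box a b) x)" for a b
  proof -
    have "set_integrable lborel (cbox a b) g"
      using g by (simp add: locally_integrable_def)
    then have "set_integrable lborel (box a b) g"
      by (rule set_integrable_subset) (auto simp: box_subset_cbox)
    then show ?thesis by (simp add: set_integrable_def mult.commute)
  qed
  have box_0: "(LINT x|lborel. g x * indicator (box a b) x) = 0" for a b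
  proof -
    have "(\<lambda>k. LINT x|lborel. g x * box_bump (real (Suc k)) a b x) \<longlonglongrightarrow>
        (LINT x|lborel. g x * indicator (box a b) x)"
    proof (rule integral_dominated_convergence)
      show "integrable lborel (\<lambda>x. \<bar>g x * indicator (box a b) x\<bar>)"
        using box_int by (rule integrable_abs)
      show "(\<lambda>x. g x * box_bump (real (Suc k)) a b x) \<in> borel_measurable lborel" for k
      proof -
        have "box_bump (real (Suc k)) a b \<in> borel_measurable borel"
          using test_function_box_bump[of "real (Suc k)" a b]
          by (auto simp: test_function_iff intro: smooth_borel_measurable)
        then show ?thesis by simp
      qed
      show "AE x in lborel. (\<lambda>k. g x * box_bump (real (Suc k)) a b x)
          \<longlonglongrightarrow> g x * indicator (box a b) x"
        by (intro AE_I2 tendsto_mult_left box_bump_tendsto)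
      show "AE x in lborel. norm (g x * box_bump (real (Suc k)) a b x)
          \<le> \<bar>g x * indicator (box a b) x\<bar>" for k
      proof (rule AE_I2)
        fix x
        show "norm (g x * box_bump (real (Suc k)) a b x) \<le> \<bar>g x * indicator (box a b) x\<bar>"
          using box_bump_le_1[of "real (Suc k)" a b x] box_bump_nonneg[of "real (Suc k)" a b x]
            box_bump_eq_0[of "real (Suc k)" x a b]
          by (cases "x \<in> box a b") (auto simp: abs_mult mult_left_le)
      qed
    qed simp
    moreover have "(LINT x|lborel. g x * box_bump (real (Suc k)) a b x) = 0" for k
      by (intro orth test_function_box_bump) simp
    ultimately show ?thesis by (simp add: LIMSEQ_const_iff)
  qed
  \<comment> \<open>\<open>ennreal\<close> sends negative reals to 0, so
    \<open>ennreal (g x)\<close> and \<open>ennreal (- g x)\<close> are the positive and the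
    negative part of \<open>g\<close>. Finiteness is what allows the equality of the two real
    integrals to be lifted to \<open>ennreal\<close>.\<close>
  have parts: "(\<integral>\<^sup>+x. ennreal (g x * indicator (box a b) x) \<partial>lborel) =
        (\<integral>\<^sup>+x. ennreal (- (g x * indicator (box a b) x)) \<partial>lborel)"
      "(\<integral>\<^sup>+x. ennreal (g x * indicator (box a b) x) \<partial>lborel) < \<infinity>" for a b
  proof -
    have "enn2real (\<integral>\<^sup>+x. ennreal (g x * indicator (box a b) x) \<partial>lborel) =
        enn2real (\<integral>\<^sup>+x. ennreal (- (g x * indicator (box a b) x)) \<partial>lborel)"
      using box_0[of a b] unfolding real_lebesgue_integral_def[OF box_int] by simp
    moreover show "(\<integral>\<^sup>+x. ennreal (g x * indicator (box a b) x) \<partial>lborel) < \<infinity>"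
      using box_int[of a b] by (auto simp: real_integrable_def top.not_eq_extremum)
    moreover have "(\<integral>\<^sup>+x. ennreal (- (g x * indicator (box a b) x)) \<partial>lborel) < \<infinity>"
      using box_int[of a b] by (auto simp: real_integrable_def top.not_eq_extremum)
    ultimately show "(\<integral>\<^sup>+x. ennreal (g x * indicator (box a b) x) \<partial>lborel) =
        (\<integral>\<^sup>+x. ennreal (- (g x * indicator (box a b) x)) \<partial>lborel)"
      by (metis ennreal_enn2real infinity_ennreal_def)
  qed
  have em: "emeasure (density lborel (\<lambda>x. ennreal (f x))) (box a b) =
      (\<integral>\<^sup>+x. ennreal (f x * indicator (box a b) x) \<partial>lborel)"
    if "f \<in> borel_measurable borel" for f :: "'v \<Rightarrow> real" and a b
    using that by (subst emeasure_density) (auto intro!: nn_integral_cong simp: indicator_def)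
  \<comment> \<open>Boxes are stable under intersection, generate the Borel sets and exhaust the
    space with finite measure. Once the measures agree, the two parts of \<open>g\<close> agree
    almost everywhere, and since one of them is always 0, both vanish.\<close>
  have "density lborel (\<lambda>x. ennreal (g x)) = density lborel (\<lambda>x. ennreal (- g x))"
  proof (rule measure_eqI_generator_eq)
    let ?E = "range (\<lambda>(a, b). box a b::'v set)"
    show "Int_stable ?E"
      by (auto simp: Int_stable_def box_Int_box)
    show "?E \<subseteq> Pow UNIV" "sets (density lborel (\<lambda>x. ennreal (g x))) = sigma_sets UNIV ?E"
      "sets (density lborel (\<lambda>x. ennreal (- g x))) = sigma_sets UNIV ?E"
      by (simp_all add: borel_eq_box)
    let ?A = "\<lambda>n::nat. box (- (real n *\<^sub>R One)) (real n *\<^sub>R One) :: 'v set"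
    show "range ?A \<subseteq> ?E" "(\<Union>i. ?A i) = UNIV"
      unfolding UN_box_eq_UNIV by auto
    show "emeasure (density lborel (\<lambda>x. ennreal (g x))) (?A i) \<noteq> \<infinity>" for i
      using parts(2)[of "- (real i *\<^sub>R One)" "real i *\<^sub>R One"] by (simp add: em less_top)
    show "emeasure (density lborel (\<lambda>x. ennreal (g x))) X =
        emeasure (density lborel (\<lambda>x. ennreal (- g x))) X" if "X \<in> ?E" for X
      using that parts(1) by (auto simp: em)
  qed
  then have "AE x in lborel. ennreal (g x) = ennreal (- g x)"
    by (intro sigma_finite_measure.density_unique[OF sigma_finite_lborel]) auto
  then show ?thesis
  proof eventually_elim
    case (elim x)
    then show ?case
      by (cases "g x \<ge> 0") (auto simp: ennreal_neg ennreal_eq_0_iff)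
  qed
qed

text \<open>The difference of two weak derivatives is orthogonal to every test function. This is
  what gives access to the representative picked by \<open>weak_deriv\<close>.\<close>

lemma has_weak_deriv_unique:
  assumes "has_weak_deriv e \<alpha> f g" "has_weak_deriv e \<alpha> f h"
  shows "AE x in lborel. g x = h x"
proof -
  have gh: "locally_integrable g" "locally_integrable h"
    using assms by (auto simp: has_weak_deriv_def)
  have "AE x in lborel. g x - h x = 0"
  proof (rule AE_zero_if_orthogonal_to_test_functions)
    show "locally_integrable (\<lambda>x. g x - h x)"
      using gh by (auto simp: locally_integrable_def set_integrable_def scaleR_diff_right
          simp del: real_scaleR_def)
    fix \<phi> :: "'b \<Rightarrow> real" assume \<phi>: "test_function \<phi>"
    have "(-1) ^ order_of \<alpha> * (LINT x|lborel. g x * \<phi> x) =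
        (-1) ^ order_of \<alpha> * (LINT x|lborel. h x * \<phi> x)"
      using assms \<phi> unfolding has_weak_deriv_def by metis
    then show "(LINT x|lborel. (g x - h x) * \<phi> x) = 0"
      using locally_integrable_mult_test_function[OF gh(1) \<phi>]
        locally_integrable_mult_test_function[OF gh(2) \<phi>]
      by (simp add: left_diff_distrib)
  qed
  then show ?thesis by simp
qed

text \<open>The Sobolev norm differentiates \<open>weak_deriv dir1 \<alpha>1 f\<close>, which equals
  the classical derivative only almost everywhere; this passes from one to the other.\<close>

lemma has_weak_deriv_cong_AE:
  assumes "has_weak_deriv e \<alpha> f g" "AE x in lborel. f x = f' x" "locally_integrable f'"
  shows "has_weak_deriv e \<alpha> f' g"
proof -
  obtain vs where vs: "multi_deriv e \<alpha> = iter_deriv vs"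
    using multi_deriv_eq_iter_deriv by metis
  have "(LINT x|lborel. f' x * multi_deriv e \<alpha> \<phi> x) = (LINT x|lborel. f x * multi_deriv e \<alpha> \<phi> x)"
    if "test_function \<phi>" for \<phi>
  proof (rule integral_cong_AE)
    have [measurable]: "multi_deriv e \<alpha> \<phi> \<in> borel_measurable borel"
      using test_function_iter_deriv[OF that] unfolding vs
      by (simp add: test_function_iff smooth_borel_measurable)
    have [measurable]: "f \<in> borel_measurable borel" "f' \<in> borel_measurable borel"
      using assms by (auto simp: has_weak_deriv_def locally_integrable_def)
    show "(\<lambda>x. f' x * multi_deriv e \<alpha> \<phi> x) \<in> borel_measurable lborel"
      "(\<lambda>x. f x * multi_deriv e \<alpha> \<phi> x) \<in> borel_measurable lborel" by simp_all
    show "AE x in lborel. f' x * multi_deriv e \<alpha> \<phi> x = f x * multi_deriv e \<alpha> \<phi> x"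
      using assms(2) by eventually_elim simp
  qed
  then show ?thesis
    using assms by (simp add: has_weak_deriv_def)
qed

text \<open>Integration by parts reverses the order of differentiation. Keeping the reversed order makes
  the symmetry of mixed partial derivatives unnecessary.\<close>

lemma has_weak_deriv_test_function:
  obtains vs where "length vs = order_of \<alpha>"
    "\<And>f. test_function f \<Longrightarrow> has_weak_deriv e \<alpha> f (iter_deriv vs f)"
proof -
  obtain vs where vs: "multi_deriv e \<alpha> = iter_deriv vs" "length vs = order_of \<alpha>"
    by (rule multi_deriv_eq_iter_deriv)
  show ?thesis
    using vs by (intro that[of "rev vs"])
      (auto simp: has_weak_deriv_def test_function_locally_integrable test_function_iter_deriv
        integral_by_parts_iter_deriv)
qed

text \<open>The list \<open>ws\<close> is fixed before \<open>f\<close>. One and the same classical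
  derivative thus serves all densities of the construction, and its norm on the base bump is a
  constant independent of \<open>l\<close>, \<open>n\<close> and the positions.\<close>

lemma mixed_weak_deriv_test_function:
  fixes d :: "'i::finite \<Rightarrow> 'v::euclidean_space" and e :: "'j::finite \<Rightarrow> 'v"
  obtains ws where "length ws = order_of \<alpha> + order_of \<beta>"
    "\<And>f. test_function f \<Longrightarrow> \<exists>g. has_weak_deriv d \<alpha> f g"
    "\<And>f. test_function f \<Longrightarrow> \<exists>h. has_weak_deriv e \<beta> (weak_deriv d \<alpha> f) h"
    "\<And>f. test_function f \<Longrightarrow> weak_deriv e \<beta> (weak_deriv d \<alpha> f) \<in> borel_measurable borel"
    "\<And>f. test_function f \<Longrightarrow>
      AE x in lborel. weak_deriv e \<beta> (weak_deriv d \<alpha> f) x = iter_deriv ws f x"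
proof -
  obtain us where us: "length us = order_of \<alpha>"
    "\<And>f. test_function f \<Longrightarrow> has_weak_deriv d \<alpha> f (iter_deriv us f)"
    using has_weak_deriv_test_function[of \<alpha> d] by metis
  obtain vs where vs: "length vs = order_of \<beta>"
    "\<And>f. test_function f \<Longrightarrow> has_weak_deriv e \<beta> f (iter_deriv vs f)"
    using has_weak_deriv_test_function[of \<beta> e] by metis
  have wd: "has_weak_deriv d \<alpha> f (weak_deriv d \<alpha> f)" if "test_function f" for f
    unfolding weak_deriv_def by (rule someI[of "has_weak_deriv d \<alpha> f"]) (rule us(2)[OF that])
  have *: "has_weak_deriv e \<beta> (weak_deriv d \<alpha> f) (iter_deriv (vs @ us) f)" if "test_function f" for f
  proof -
    have "has_weak_deriv e \<beta> (iter_deriv us f) (iter_deriv vs (iter_deriv us f))"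
      by (intro vs(2) test_function_iter_deriv that)
    moreover have "AE x in lborel. iter_deriv us f x = weak_deriv d \<alpha> f x"
      by (rule has_weak_deriv_unique[OF us(2)[OF that] wd[OF that]])
    moreover have "locally_integrable (weak_deriv d \<alpha> f)"
      using wd[OF that] by (simp add: has_weak_deriv_def)
    ultimately have "has_weak_deriv e \<beta> (weak_deriv d \<alpha> f) (iter_deriv vs (iter_deriv us f))"
      by (rule has_weak_deriv_cong_AE)
    then show ?thesis by simp
  qed
  have wd2: "has_weak_deriv e \<beta> (weak_deriv d \<alpha> f) (weak_deriv e \<beta> (weak_deriv d \<alpha> f))"
    if "test_function f" for f
    unfolding weak_deriv_def[of e]
    by (rule someI[of "has_weak_deriv e \<beta> (weak_deriv d \<alpha> f)"]) (rule *[OF that])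
  show ?thesis
  proof (rule that[of "vs @ us"])
    show "length (vs @ us) = order_of \<alpha> + order_of \<beta>" using us vs by simp
    fix f :: "'v \<Rightarrow> real" assume f: "test_function f"
    show "\<exists>g. has_weak_deriv d \<alpha> f g" "\<exists>h. has_weak_deriv e \<beta> (weak_deriv d \<alpha> f) h"
      using us(2)[OF f] *[OF f] by auto
    show "weak_deriv e \<beta> (weak_deriv d \<alpha> f) \<in> borel_measurable borel"
      using wd2[OF f] by (simp add: has_weak_deriv_def locally_integrable_def)
    show "AE x in lborel. weak_deriv e \<beta> (weak_deriv d \<alpha> f) x = iter_deriv (vs @ us) f x"
      by (rule has_weak_deriv_unique[OF wd2[OF f] *[OF f]])
  qed
qed

section \<open>Indistinguishable samples\<close>

text \<open>Provides the product measure locale both for a full density (\<open>A = UNIV\<close>)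
  and for one cut down to the complement of a cell.\<close>

lemma prob_density_sigma_finite:
  assumes "prob_density f" "A \<in> sets borel"
  shows "sigma_finite_measure (density lborel (\<lambda>x. ennreal (f x) * indicator A x))"
proof -
  have [measurable]: "f \<in> borel_measurable borel" "A \<in> sets borel"
    using assms by (auto simp: prob_density_def)
  have "(\<integral>\<^sup>+x. ennreal (f x) * indicator A x \<partial>lborel) \<le> (\<integral>\<^sup>+x. ennreal (f x) \<partial>lborel)"
    by (intro nn_integral_mono) (auto simp: indicator_def)
  then have "finite_measure (density lborel (\<lambda>x. ennreal (f x) * indicator A x))"
    using assms by (intro finite_measureI) (auto simp: emeasure_density prob_density_def top_unique)
  then show ?thesis by (rule finite_measure.axioms(1))
qed

lemma sets_iid_sample: "sets (iid_sample n f) = sets (PiM {..<n} (\<lambda>_. borel))"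
  unfolding iid_sample_def by (intro sets_PiM_cong) auto

definition avoid :: "nat \<Rightarrow> 'v set \<Rightarrow> (nat \<Rightarrow> 'v) set" where
  "avoid n C = (\<Pi>\<^sub>E i\<in>{..<n}. - C)"

lemma avoid_measurable: "C \<in> sets borel \<Longrightarrow> avoid n C \<in> sets (PiM {..<n} (\<lambda>_. borel))"
  unfolding avoid_def by (intro sets_PiM_I_finite) auto

lemma emeasure_iid_sample_avoid:
  assumes "prob_density f" "C \<in> sets borel"
    "emeasure (density lborel (\<lambda>x. ennreal (f x))) (- C) = q"
  shows "emeasure (iid_sample n f) (avoid n C) = q ^ n"
proof -
  interpret product_sigma_finite "\<lambda>_::nat. density lborel (\<lambda>x. ennreal (f x))"
    using prob_density_sigma_finite[OF assms(1), of UNIV] by (simp add: product_sigma_finite_def)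
  show ?thesis
    unfolding iid_sample_def avoid_def using assms(2,3) borel_comp[of C]
    by (subst emeasure_PiM) simp_all
qed

text \<open>The indicator of a product event factorises, so restricting the sample to
  \<open>avoid n C\<close> amounts to cutting down every factor. The right-hand side sees
  \<open>f\<close> only off \<open>C\<close>; this is why densities that agree there cannot be told
  apart on this event.\<close>

lemma density_iid_sample_avoid:
  assumes f: "prob_density f" and C: "C \<in> sets borel"
  shows "density (iid_sample n f) (indicator (avoid n C)) =
    PiM {..<n} (\<lambda>_. density lborel (\<lambda>x. ennreal (f x) * indicator (- C) x))"
proof -
  have [measurable]: "f \<in> borel_measurable borel" "C \<in> sets borel" "- C \<in> sets borel"
    using f C by (auto simp: prob_density_def)
  interpret N: product_sigma_finite "\<lambda>_::nat. density lborel (\<lambda>x. ennreal (f x))"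
    using prob_density_sigma_finite[OF f, of UNIV] by (simp add: product_sigma_finite_def)
  interpret N': product_sigma_finite "\<lambda>_::nat. density lborel (\<lambda>x. ennreal (f x) * indicator (- C) x)"
    using prob_density_sigma_finite[OF f, of "- C"] by (simp add: product_sigma_finite_def)
  show ?thesis
  proof (rule N'.PiM_eqI)
    show "sets (density (iid_sample n f) (indicator (avoid n C))) =
        sets (PiM {..<n} (\<lambda>_. density lborel (\<lambda>x. ennreal (f x) * indicator (- C) x)))"
      by (simp add: sets_iid_sample) (intro sets_PiM_cong, auto)
    fix X :: "nat \<Rightarrow> 'a set"
    assume "\<And>i. i \<in> {..<n} \<Longrightarrow> X i \<in> sets (density lborel (\<lambda>x. ennreal (f x) * indicator (- C) x))"
    then have X: "X i \<in> sets borel" if "i < n" for i using that by auto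
    have "emeasure (density (iid_sample n f) (indicator (avoid n C))) (Pi\<^sub>E {..<n} X) =
        emeasure (iid_sample n f) (avoid n C \<inter> Pi\<^sub>E {..<n} X)"
      using X avoid_measurable[OF C, of n]
      by (intro emeasure_restricted) (auto simp: sets_iid_sample intro!: sets_PiM_I_finite)
    also have "avoid n C \<inter> Pi\<^sub>E {..<n} X = Pi\<^sub>E {..<n} (\<lambda>i. X i \<inter> - C)"
      by (auto simp: avoid_def PiE_iff)
    also have "emeasure (iid_sample n f) \<dots> =
        (\<Prod>i<n. emeasure (density lborel (\<lambda>x. ennreal (f x))) (X i \<inter> - C))"
      unfolding iid_sample_def using X C by (subst N.emeasure_PiM) auto
    also have "\<dots> = (\<Prod>i<n. emeasure (density lborel (\<lambda>x. ennreal (f x) * indicator (- C) x)) (X i))"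
      using X C by (intro prod.cong refl)
        (auto simp: emeasure_density intro!: nn_integral_cong simp: indicator_def)
    finally show "emeasure (density (iid_sample n f) (indicator (avoid n C))) (Pi\<^sub>E {..<n} X) =
        (\<Prod>i\<in>{..<n}. emeasure (density lborel (\<lambda>x. ennreal (f x) * indicator (- C) x)) (X i))" .
  qed simp
qed

lemma nn_integral_iid_sample_avoid_cong:
  assumes "prob_density f" "prob_density g" "C \<in> sets borel"
    and "\<And>x. x \<notin> C \<Longrightarrow> f x = g x"
    and G: "G \<in> borel_measurable (PiM {..<n} (\<lambda>_. borel))"
  shows "(\<integral>\<^sup>+\<omega>. indicator (avoid n C) \<omega> * G \<omega> \<partial>iid_sample n f) =
    (\<integral>\<^sup>+\<omega>. indicator (avoid n C) \<omega> * G \<omega> \<partial>iid_sample n g)"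
proof -
  have "(\<lambda>x. ennreal (f x) * indicator (- C) x) = (\<lambda>x. ennreal (g x) * indicator (- C) x)"
    using assms(4) by (auto simp: fun_eq_iff indicator_def)
  then have eq: "density (iid_sample n f) (indicator (avoid n C)) =
      density (iid_sample n g) (indicator (avoid n C))"
    using assms by (simp add: density_iid_sample_avoid)
  have "(\<integral>\<^sup>+\<omega>. indicator (avoid n C) \<omega> * G \<omega> \<partial>iid_sample n h) =
      (\<integral>\<^sup>+\<omega>. G \<omega> \<partial>density (iid_sample n h) (indicator (avoid n C)))" for h :: "'a \<Rightarrow> real"
    using G avoid_measurable[OF assms(3), of n] measurable_cong_sets[OF sets_iid_sample refl]
    by (subst nn_integral_density) (auto simp: sets_iid_sample intro!: borel_measurable_indicator)
  then show ?thesis by (simp add: eq)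
qed

section \<open>Two-point and hypercube lower bounds\<close>

lemma abs_diff_powr_le:
  fixes a b t p :: real
  assumes "p \<ge> 0"
  shows "\<bar>a - b\<bar> powr p \<le> 2 powr p * (\<bar>t - a\<bar> powr p + \<bar>t - b\<bar> powr p)"
proof -
  have "\<bar>a - b\<bar> \<le> \<bar>t - a\<bar> + \<bar>t - b\<bar>" by linarith
  \<comment> \<open>The maximum commutes with the power, so no convexity is involved. The price is
    the factor \<open>2 powr p\<close>, which reappears in the final constant.\<close>
  also have "\<dots> \<le> 2 * max \<bar>t - a\<bar> \<bar>t - b\<bar>" by (simp add: max_def)
  finally have "\<bar>a - b\<bar> powr p \<le> (2 * max \<bar>t - a\<bar> \<bar>t - b\<bar>) powr p"
    using assms by (intro powr_mono2) simp_all
  also have "\<dots> = 2 powr p * max \<bar>t - a\<bar> \<bar>t - b\<bar> powr p"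
    by (simp add: powr_mult)
  also have "\<dots> \<le> 2 powr p * (\<bar>t - a\<bar> powr p + \<bar>t - b\<bar> powr p)"
    by (intro mult_left_mono) (auto simp: max_def)
  finally show ?thesis .
qed

text \<open>No p-th root is taken, so losses on disjoint cells can be added.\<close>

definition local_loss ::
  "real \<Rightarrow> 'v::euclidean_space set \<Rightarrow> ('v \<Rightarrow> real) \<Rightarrow> ('v \<Rightarrow> real) \<Rightarrow> ennreal" where
  "local_loss p C g f = (\<integral>\<^sup>+x. ennreal (\<bar>g x - f x\<bar> powr p) * indicator C x \<partial>lborel)"

lemma local_loss_measurable:
  assumes "T \<in> estimators n" "f \<in> borel_measurable borel" "C \<in> sets borel"
  shows "(\<lambda>\<omega>. local_loss p C (T \<omega>) f) \<in> borel_measurable (PiM {..<n} (\<lambda>_. borel))"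
proof -
  have [measurable]: "(\<lambda>(\<omega>, x). T \<omega> x) \<in> borel_measurable (PiM {..<n} (\<lambda>_. borel) \<Otimes>\<^sub>M lborel)"
    using assms(1) measurable_cong_sets[OF sets_pair_measure_cong[OF refl sets_lborel] refl]
    by (auto simp: estimators_def)
  have [measurable]: "f \<in> borel_measurable borel" "C \<in> sets borel" using assms by auto
  show ?thesis
    unfolding local_loss_def by measurable
qed

text \<open>On the event that the sample misses \<open>C\<close>, of probability
  \<open>q ^ n\<close>, the estimate behaves identically under \<open>f\<close> and
  \<open>g\<close>, and by the triangle inequality it cannot be close to both of them on
  \<open>C\<close>.\<close>

lemma two_point_bound:
  assumes T: "T \<in> estimators n" and p: "p \<ge> 0"
    and fg: "prob_density f" "prob_density g" and C: "C \<in> sets borel"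
    and agree: "\<And>x. x \<notin> C \<Longrightarrow> f x = g x"
    and q: "emeasure (density lborel (\<lambda>x. ennreal (f x))) (- C) = q"
  shows "q ^ n * local_loss p C f g \<le> ennreal (2 powr p) *
    ((\<integral>\<^sup>+\<omega>. indicator (avoid n C) \<omega> * local_loss p C (T \<omega>) f \<partial>iid_sample n f) +
     (\<integral>\<^sup>+\<omega>. indicator (avoid n C) \<omega> * local_loss p C (T \<omega>) g \<partial>iid_sample n g))"
proof -
  have [measurable]: "f \<in> borel_measurable borel" "g \<in> borel_measurable borel" "C \<in> sets borel"
    using fg C by (auto simp: prob_density_def)
  have sets[measurable_cong]: "sets (iid_sample n f) = sets (PiM {..<n} (\<lambda>_. borel))"
    by (rule sets_iid_sample)
  note [measurable] = local_loss_measurable[OF T _ C] avoid_measurable[OF C, of n]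
  have tri: "local_loss p C f g \<le>
      ennreal (2 powr p) * (local_loss p C (T \<omega>) f + local_loss p C (T \<omega>) g)"
    if "\<omega> \<in> space (PiM {..<n} (\<lambda>_. borel))" for \<omega>
  proof -
    have [measurable]: "T \<omega> \<in> borel_measurable borel"
      using T that measurable_compose[OF measurable_Pair1', of \<omega> _ "\<lambda>(\<omega>, x). T \<omega> x" borel borel]
      by (auto simp: estimators_def)
    have "local_loss p C f g \<le> (\<integral>\<^sup>+x. ennreal (2 powr p) *
        (ennreal (\<bar>T \<omega> x - f x\<bar> powr p) * indicator C x + ennreal (\<bar>T \<omega> x - g x\<bar> powr p) * indicator C x) \<partial>lborel)"
      unfolding local_loss_def
    proof (rule nn_integral_mono)
      fix x
      have "ennreal (\<bar>f x - g x\<bar> powr p) \<le>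
          ennreal (2 powr p) * (ennreal (\<bar>T \<omega> x - f x\<bar> powr p) + ennreal (\<bar>T \<omega> x - g x\<bar> powr p))"
        using ennreal_leI[OF abs_diff_powr_le[OF p, of "f x" "g x" "T \<omega> x"]]
        by (simp add: ennreal_mult' ennreal_plus)
      then show "ennreal (\<bar>f x - g x\<bar> powr p) * indicator C x \<le> ennreal (2 powr p) *
          (ennreal (\<bar>T \<omega> x - f x\<bar> powr p) * indicator C x + ennreal (\<bar>T \<omega> x - g x\<bar> powr p) * indicator C x)"
        by (auto simp: indicator_def)
    qed
    also have "\<dots> = ennreal (2 powr p) * (local_loss p C (T \<omega>) f + local_loss p C (T \<omega>) g)"
      unfolding local_loss_def by (subst nn_integral_cmult) (auto simp: nn_integral_add)
    finally show ?thesis .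
  qed
  have "q ^ n * local_loss p C f g =
      (\<integral>\<^sup>+\<omega>. indicator (avoid n C) \<omega> * local_loss p C f g \<partial>iid_sample n f)"
    using emeasure_iid_sample_avoid[OF fg(1) C q, of n]
    by (subst nn_integral_multc) auto
  also have "\<dots> \<le> (\<integral>\<^sup>+\<omega>. ennreal (2 powr p) * (indicator (avoid n C) \<omega> * local_loss p C (T \<omega>) f +
      indicator (avoid n C) \<omega> * local_loss p C (T \<omega>) g) \<partial>iid_sample n f)"
    using tri sets_eq_imp_space_eq[OF sets]
    by (intro nn_integral_mono) (auto simp: indicator_def)
  also have "\<dots> = ennreal (2 powr p) *
      ((\<integral>\<^sup>+\<omega>. indicator (avoid n C) \<omega> * local_loss p C (T \<omega>) f \<partial>iid_sample n f) +
       (\<integral>\<^sup>+\<omega>. indicator (avoid n C) \<omega> * local_loss p C (T \<omega>) g \<partial>iid_sample n f))"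
    by (subst nn_integral_cmult) (auto simp: nn_integral_add)
  \<comment> \<open>Up to here all samples come from \<open>f\<close>. Agreement off
    \<open>C\<close> allows the second term to be read as a loss under \<open>g\<close>.\<close>
  also have "(\<integral>\<^sup>+\<omega>. indicator (avoid n C) \<omega> * local_loss p C (T \<omega>) g \<partial>iid_sample n f) =
      (\<integral>\<^sup>+\<omega>. indicator (avoid n C) \<omega> * local_loss p C (T \<omega>) g \<partial>iid_sample n g)"
    by (rule nn_integral_iid_sample_avoid_cong[OF fg C agree]) auto
  finally show ?thesis .
qed

text \<open>The events and the loss outside the cells are discarded; disjointness ensures that no
  point of the space is counted twice.\<close>

lemma sum_local_loss_le_Lp_risk:
  fixes C :: "nat \<Rightarrow> 'v::euclidean_space set"
  assumes T: "T \<in> estimators n" and f: "f \<in> borel_measurable borel"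
    and C: "\<And>j. j < m \<Longrightarrow> C j \<in> sets borel" and disj: "disjoint_family_on C {..<m}"
  shows "(\<Sum>j<m. \<integral>\<^sup>+\<omega>. indicator (A j) \<omega> * local_loss p (C j) (T \<omega>) f \<partial>iid_sample n f)
    \<le> Lp_risk p n T f"
proof -
  have [measurable]: "f \<in> borel_measurable borel" by fact
  have sets[measurable_cong]: "sets (iid_sample n f) = sets (PiM {..<n} (\<lambda>_. borel))"
    by (rule sets_iid_sample)
  have le: "(\<Sum>j<m. local_loss p (C j) (T \<omega>) f) \<le> (\<integral>\<^sup>+x. ennreal (\<bar>T \<omega> x - f x\<bar> powr p) \<partial>lborel)"
    if "\<omega> \<in> space (PiM {..<n} (\<lambda>_. borel))" for \<omega>
  proof -
    have [measurable]: "T \<omega> \<in> borel_measurable borel"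
      using T that measurable_compose[OF measurable_Pair1', of \<omega> _ "\<lambda>(\<omega>, x). T \<omega> x" borel borel]
      by (auto simp: estimators_def)
    have "(\<Sum>j<m. local_loss p (C j) (T \<omega>) f) =
        (\<integral>\<^sup>+x. (\<Sum>j<m. ennreal (\<bar>T \<omega> x - f x\<bar> powr p) * indicator (C j) x) \<partial>lborel)"
      unfolding local_loss_def using C by (subst nn_integral_sum) auto
    also have "\<dots> \<le> (\<integral>\<^sup>+x. ennreal (\<bar>T \<omega> x - f x\<bar> powr p) \<partial>lborel)"
    proof (rule nn_integral_mono)
      fix x
      have "(\<Sum>j<m. indicator (C j) x :: ennreal) = indicator (\<Union>j<m. C j) x"
        using disj by (intro indicator_UN_disjoint[symmetric]) auto
      then show "(\<Sum>j<m. ennreal (\<bar>T \<omega> x - f x\<bar> powr p) * indicator (C j) x)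
          \<le> ennreal (\<bar>T \<omega> x - f x\<bar> powr p)"
        unfolding sum_distrib_left[symmetric] by (auto simp: indicator_def)
    qed
    finally show ?thesis .
  qed
  have "(\<Sum>j<m. \<integral>\<^sup>+\<omega>. indicator (A j) \<omega> * local_loss p (C j) (T \<omega>) f \<partial>iid_sample n f) \<le>
      (\<Sum>j<m. \<integral>\<^sup>+\<omega>. local_loss p (C j) (T \<omega>) f \<partial>iid_sample n f)"
    by (intro sum_mono nn_integral_mono) (auto simp: indicator_def)
  also have "\<dots> = (\<integral>\<^sup>+\<omega>. (\<Sum>j<m. local_loss p (C j) (T \<omega>) f) \<partial>iid_sample n f)"
    by (subst nn_integral_sum)
      (use local_loss_measurable[OF T f C] measurable_cong_sets[OF sets refl] in auto)
  also have "\<dots> \<le> Lp_risk p n T f"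
    unfolding Lp_risk_def using le sets_eq_imp_space_eq[OF sets] by (intro nn_integral_mono) auto
  finally show ?thesis .
qed

text \<open>Assouad's scheme. For each \<open>j\<close> the two-point bound is summed over all
  vertices \<open>\<theta>\<close> of the cube, each paired with its neighbour in direction
  \<open>j\<close>. Summing over \<open>j\<close> and exchanging the sums leaves at each vertex the
  total of its local losses, hence at most its risk and so at most \<open>B\<close>.\<close>

lemma hypercube_bound:
  fixes f :: "nat set \<Rightarrow> 'v::euclidean_space \<Rightarrow> real" and q \<delta> B :: ennreal
  defines "flip \<equiv> \<lambda>(j::nat) \<theta>. if j \<in> \<theta> then \<theta> - {j} else insert j \<theta>"
  assumes T: "T \<in> estimators n" and p: "p \<ge> 0"
    and dens: "\<And>\<theta>. \<theta> \<subseteq> {..<m} \<Longrightarrow> prob_density (f \<theta>)"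
    and C: "\<And>j. j < m \<Longrightarrow> C j \<in> sets borel" and disj: "disjoint_family_on C {..<m}"
    and agree: "\<And>j \<theta> x. \<theta> \<subseteq> {..<m} \<Longrightarrow> j < m \<Longrightarrow> x \<notin> C j \<Longrightarrow> f \<theta> x = f (flip j \<theta>) x"
    and mass: "\<And>j \<theta>. \<theta> \<subseteq> {..<m} \<Longrightarrow> j < m \<Longrightarrow>
      emeasure (density lborel (\<lambda>x. ennreal (f \<theta> x))) (- C j) = q"
    and sep: "\<And>j \<theta>. \<theta> \<subseteq> {..<m} \<Longrightarrow> j < m \<Longrightarrow> \<delta> \<le> local_loss p (C j) (f \<theta>) (f (flip j \<theta>))"
    and B: "\<And>\<theta>. \<theta> \<subseteq> {..<m} \<Longrightarrow> Lp_risk p n T (f \<theta>) \<le> B"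
  shows "of_nat m * (q ^ n * \<delta>) \<le> ennreal (2 powr p) * (2 * B)"
proof -
  define R where "R j \<theta> = (\<integral>\<^sup>+\<omega>. indicator (avoid n (C j)) \<omega> * local_loss p (C j) (T \<omega>) (f \<theta>)
    \<partial>iid_sample n (f \<theta>))" for j \<theta>
  have flip: "flip j \<theta> \<subseteq> {..<m}" "flip j (flip j \<theta>) = \<theta>" if "\<theta> \<subseteq> {..<m}" "j < m" for j \<theta>
    using that by (auto simp: flip_def)
  have card: "(\<Sum>\<theta>\<in>Pow {..<m}. c) = 2 ^ m * c" for c :: ennreal
    by (simp add: card_Pow)
  have pt: "2 ^ m * (q ^ n * \<delta>) \<le> ennreal (2 powr p) * (2 * (\<Sum>\<theta>\<in>Pow {..<m}. R j \<theta>))" if j: "j < m" for j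
  proof -
    have "2 ^ m * (q ^ n * \<delta>) = (\<Sum>\<theta>\<in>Pow {..<m}. q ^ n * \<delta>)"
      by (simp only: card)
    also have "\<dots> \<le> (\<Sum>\<theta>\<in>Pow {..<m}. ennreal (2 powr p) * (R j \<theta> + R j (flip j \<theta>)))"
    proof (rule sum_mono)
      fix \<theta> assume "\<theta> \<in> Pow {..<m}"
      then have th: "\<theta> \<subseteq> {..<m}" by simp
      have "q ^ n * \<delta> \<le> q ^ n * local_loss p (C j) (f \<theta>) (f (flip j \<theta>))"
        by (intro mult_left_mono sep th j) simp
      also have "\<dots> \<le> ennreal (2 powr p) * (R j \<theta> + R j (flip j \<theta>))"
        unfolding R_def
        by (intro two_point_bound T p dens th flip C j mass agree)
      finally show "q ^ n * \<delta> \<le> ennreal (2 powr p) * (R j \<theta> + R j (flip j \<theta>))" .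
    qed
    also have "\<dots> = ennreal (2 powr p) *
        ((\<Sum>\<theta>\<in>Pow {..<m}. R j \<theta>) + (\<Sum>\<theta>\<in>Pow {..<m}. R j (flip j \<theta>)))"
      by (simp only: sum_distrib_left[symmetric] sum.distrib)
    \<comment> \<open>\<open>flip j\<close> is an involution of the vertices, so both sums are
      equal; this is the factor 2 in the bound.\<close>
    also have "(\<Sum>\<theta>\<in>Pow {..<m}. R j (flip j \<theta>)) = (\<Sum>\<theta>\<in>Pow {..<m}. R j \<theta>)"
      by (rule sum.reindex_bij_witness[of _ "flip j" "flip j"]) (use flip j in auto)
    finally show ?thesis by (simp add: mult_2)
  qed
  have "2 ^ m * (of_nat m * (q ^ n * \<delta>)) = (\<Sum>j<m. 2 ^ m * (q ^ n * \<delta>))"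
    by (simp add: mult.left_commute)
  also have "\<dots> \<le> (\<Sum>j<m. ennreal (2 powr p) * (2 * (\<Sum>\<theta>\<in>Pow {..<m}. R j \<theta>)))"
    by (intro sum_mono pt) simp
  also have "\<dots> = ennreal (2 powr p) * (2 * (\<Sum>\<theta>\<in>Pow {..<m}. \<Sum>j<m. R j \<theta>))"
    unfolding sum_distrib_left[symmetric] by (subst sum.swap) simp
  also have "\<dots> \<le> ennreal (2 powr p) * (2 * (\<Sum>\<theta>\<in>Pow {..<m}. B))"
  proof (intro mult_left_mono sum_mono)
    fix \<theta> assume "\<theta> \<in> Pow {..<m}"
    then have th: "\<theta> \<subseteq> {..<m}" by simp
    have "(\<Sum>j<m. R j \<theta>) \<le> Lp_risk p n T (f \<theta>)"
      unfolding R_def using dens[OF th]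
      by (intro sum_local_loss_le_Lp_risk T C disj) (auto simp: prob_density_def)
    also have "\<dots> \<le> B" by (rule B[OF th])
    finally show "(\<Sum>j<m. R j \<theta>) \<le> B" .
  qed auto
  also have "\<dots> = 2 ^ m * (ennreal (2 powr p) * (2 * B))"
    by (simp only: card) (simp add: mult_ac)
  finally show ?thesis
    by (subst (asm) ennreal_mult_le_mult_iff) (auto simp: power_eq_top_ennreal)
qed

section \<open>Spread-out densities\<close>

lemma lborel_scaleR_shift:
  fixes a :: "'v::euclidean_space"
  assumes "l > 0"
  shows "lborel = density (distr lborel borel (\<lambda>x. l *\<^sub>R (x - a))) (\<lambda>_. ennreal (l ^ DIM('v)))"
  using lborel_affine[of l "- (l *\<^sub>R a)"] assms by (simp add: algebra_simps)

lemma nn_integral_scaleR_shift: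
  fixes a :: "'v::euclidean_space"
  assumes "l > 0" and [measurable]: "F \<in> borel_measurable borel"
  shows "ennreal (l ^ DIM('v)) * (\<integral>\<^sup>+x. F (l *\<^sub>R (x - a)) \<partial>lborel) = (\<integral>\<^sup>+x. F x \<partial>lborel)"
  by (subst (2) lborel_scaleR_shift[OF assms(1), of a])
    (simp add: nn_integral_density nn_integral_distr nn_integral_cmult)

lemma integral_scaleR_shift:
  fixes a :: "'v::euclidean_space" and F :: "'v \<Rightarrow> real"
  assumes "l > 0" and [measurable]: "F \<in> borel_measurable borel"
  shows "l ^ DIM('v) * (LINT x|lborel. F (l *\<^sub>R (x - a))) = (LINT x|lborel. F x)"
  using assms(1) by (subst (2) lborel_scaleR_shift[OF assms(1), of a])
    (simp add: integral_density integral_distr)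

lemma ex_base_bump:
  obtains \<psi> :: "'v::euclidean_space \<Rightarrow> real" where
    "test_function \<psi>" "prob_density \<psi>" "\<And>x. \<psi> x \<noteq> 0 \<Longrightarrow> x \<in> cbox (- One) One"
proof -
  let ?b = "box_bump 1 (- One) (One::'v)"
  have b: "test_function ?b" by (rule test_function_box_bump) simp
  have int: "integrable lborel ?b" by (rule test_function_integrable[OF b])
  define J where "J = (LINT x|lborel. ?b x)"
  \<comment> \<open>The bump is positive on an open box of positive volume, so its integral can be
    divided out.\<close>
  have "J \<noteq> 0"
  proof
    assume "J = 0"
    then have "AE x in lborel. ?b x = 0"
      unfolding J_def using int by (subst (asm) integral_nonneg_eq_0_iff_AE) (auto simp: box_bump_nonneg)
    then have "AE x in lborel. x \<notin> box (- One) (One::'v)"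
      by eventually_elim (use box_bump_pos[of 1] in fastforce)
    then have "emeasure lborel (box (- One) (One::'v)) = 0"
      by (subst (asm) AE_iff_measurable[of "box (- One) (One::'v)"]) auto
    moreover have "emeasure lborel (box (- One) (One::'v)) = ennreal (\<Prod>b\<in>Basis. (One - - One :: 'v) \<bullet> b)"
      by (rule emeasure_lborel_box) simp
    ultimately show False by (simp add: inner_simps)
  qed
  moreover have "J \<ge> 0" unfolding J_def by (intro Bochner_Integration.integral_nonneg) (auto simp: box_bump_nonneg)
  ultimately have J: "J > 0" by simp
  define \<psi> where "\<psi> x = ?b x * (1 / J)" for x
  have t: "test_function \<psi>"
    unfolding \<psi>_def by (intro test_function_mult b smooth_const)
  have "(\<integral>\<^sup>+x. ennreal (\<psi> x) \<partial>lborel) = ennreal (LINT x|lborel. \<psi> x)"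
    using J by (intro nn_integral_eq_integral test_function_integrable t)
      (auto simp: \<psi>_def box_bump_nonneg)
  also have "(LINT x|lborel. \<psi> x) = 1"
    using J by (simp add: \<psi>_def J_def[symmetric])
  finally have "prob_density \<psi>"
    using t J by (auto simp: prob_density_def test_function_iff smooth_borel_measurable \<psi>_def box_bump_nonneg)
  moreover have "x \<in> cbox (- One) One" if "\<psi> x \<noteq> 0" for x
    using that box_bump_eq_0[of 1 x "- One" One] box_subset_cbox[of "- One" One] by (auto simp: \<psi>_def)
  ultimately show ?thesis using t that by blast
qed

text \<open>If \<open>g\<close> is supported in \<open>[-1,1]^d\<close>, then piece \<open>k\<close> is supported in strip \<open>k\<close>; the factor 3 separates
  the strips.\<close>

definition piece :: "('v::euclidean_space \<Rightarrow> real) \<Rightarrow> real \<Rightarrow> 'v \<Rightarrow> nat \<Rightarrow> 'v \<Rightarrow> real" where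
  "piece g l u k x = g (l *\<^sub>R (x - (3 * real k / l) *\<^sub>R u))"

definition strip :: "real \<Rightarrow> 'v::euclidean_space \<Rightarrow> nat \<Rightarrow> 'v set" where
  "strip l u k = {x. \<bar>l * (x \<bullet> u) - 3 * real k\<bar> \<le> 1}"

text \<open>The map \<open>s\<close> lists the strips that are occupied. The factor
  \<open>l ^ DIM('v)\<close> undoes the shrinking of volume, so for a density \<open>g\<close> each
  piece has mass \<open>1 / real n\<close>.\<close>

definition spread ::
  "('v::euclidean_space \<Rightarrow> real) \<Rightarrow> real \<Rightarrow> 'v \<Rightarrow> nat \<Rightarrow> (nat \<Rightarrow> nat) \<Rightarrow> 'v \<Rightarrow> real" where
  "spread g l u n s x = (\<Sum>j<n. l ^ DIM('v) / real n * piece g l u (s j) x)"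

lemma strip_measurable: "strip l u k \<in> sets borel"
  unfolding strip_def by measurable

lemma strip_unique:
  assumes "x \<in> strip l u k" "x \<in> strip l u k'"
  shows "k = k'"
proof (rule ccontr)
  assume "k \<noteq> k'"
  then have "\<bar>real k - real k'\<bar> \<ge> 1" by linarith
  then show False using assms unfolding strip_def by auto
qed

lemma piece_eq_0:
  assumes "\<And>x. g x \<noteq> 0 \<Longrightarrow> x \<in> cbox (- One) One" "u \<in> Basis" "l > 0" "x \<notin> strip l u k"
  shows "piece g l u k x = 0"
proof (rule ccontr)
  assume "piece g l u k x \<noteq> 0"
  then have "l *\<^sub>R (x - (3 * real k / l) *\<^sub>R u) \<in> cbox (- One) One"
    using assms(1) unfolding piece_def by blast
  then have "\<bar>(l *\<^sub>R (x - (3 * real k / l) *\<^sub>R u)) \<bullet> u\<bar> \<le> 1"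
    using assms(2) by (auto simp: mem_box abs_le_iff inner_simps)
  moreover have "(l *\<^sub>R (x - (3 * real k / l) *\<^sub>R u)) \<bullet> u = l * (x \<bullet> u) - 3 * real k"
    using assms(2,3) by (simp add: inner_simps right_diff_distrib)
  ultimately show False using assms(4) by (simp add: strip_def)
qed

text \<open>At most one summand is nonzero, and the others contribute nothing on the right because
  \<open>0 powr p = 0\<close>.\<close>

lemma powr_sum_disjoint:
  fixes f :: "'a \<Rightarrow> real"
  assumes "finite I" "\<And>i j. i \<in> I \<Longrightarrow> j \<in> I \<Longrightarrow> f i \<noteq> 0 \<Longrightarrow> f j \<noteq> 0 \<Longrightarrow> i = j"
  shows "\<bar>\<Sum>i\<in>I. f i\<bar> powr p = (\<Sum>i\<in>I. \<bar>f i\<bar> powr p)"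
proof (cases "\<exists>i\<in>I. f i \<noteq> 0")
  case True
  then obtain i where i: "i \<in> I" "f i \<noteq> 0" by blast
  then have "f j = 0" if "j \<in> I - {i}" for j
    using assms(2)[of i j] that by blast
  then show ?thesis
    using assms(1) i(1) by (simp add: sum.remove)
qed simp

section \<open>Regularity and derivatives of spread-out densities\<close>

lemma piece_measurable: "g \<in> borel_measurable borel \<Longrightarrow> piece g l u k \<in> borel_measurable borel"
  unfolding piece_def[abs_def] by (rule measurable_compose[of _ borel borel]) measurable

lemma test_function_piece:
  assumes "test_function g" "l > 0"
  shows "test_function (piece g l u k)"
proof -
  let ?a = "(3 * real k / l) *\<^sub>R u"
  have "{x. piece g l u k x \<noteq> 0} \<subseteq> (\<lambda>y. ?a + (1 / l) *\<^sub>R y) ` {x. g x \<noteq> 0}"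
  proof
    fix x assume "x \<in> {x. piece g l u k x \<noteq> 0}"
    moreover have "x = ?a + (1 / l) *\<^sub>R (l *\<^sub>R (x - ?a))" using assms(2) by simp
    ultimately show "x \<in> (\<lambda>y. ?a + (1 / l) *\<^sub>R y) ` {x. g x \<noteq> 0}"
      unfolding piece_def by blast
  qed
  moreover have "bounded ((\<lambda>y. ?a + (1 / l) *\<^sub>R y) ` {x. g x \<noteq> 0})"
    using bounded_translation[OF bounded_scaling, of "{x. g x \<noteq> 0}" ?a "1 / l"] assms(1)
    by (simp add: test_function_iff image_image)
  ultimately show ?thesis
    using assms(1) smooth_scaleR_shift[of g l ?a]
    by (auto simp: test_function_iff piece_def[abs_def] intro: bounded_subset)
qed

lemma test_function_add: "test_function f \<Longrightarrow> test_function g \<Longrightarrow> test_function (\<lambda>x. f x + g x)"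
  unfolding test_function_iff
  by (auto intro: smooth_add bounded_subset[OF bounded_Un[THEN iffD2], of "{x. f x \<noteq> 0}" "{x. g x \<noteq> 0}"])

lemma test_function_cmult: "test_function f \<Longrightarrow> test_function (\<lambda>x. c * f x)"
  unfolding test_function_iff using smooth_mult[OF smooth_const, of f c]
  by (auto intro: bounded_subset)

lemma test_function_sum:
  "(\<And>i. i \<in> I \<Longrightarrow> test_function (f i)) \<Longrightarrow> test_function (\<lambda>x. \<Sum>i\<in>I. f i x)"
proof (induction I rule: infinite_finite_induct)
  case (insert i I)
  then show ?case by (simp add: test_function_add)
qed (simp_all add: test_function_iff smooth_const)

lemma test_function_spread:
  assumes "test_function g" "l > 0"
  shows "test_function (spread g l u n s)"
  unfolding spread_def[abs_def]
  by (intro test_function_sum test_function_cmult test_function_piece assms)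

lemma smooth_piece: "smooth g \<Longrightarrow> smooth (piece g l u k)"
  unfolding piece_def[abs_def] by (rule smooth_scaleR_shift)

lemma dir_deriv_piece:
  "smooth g \<Longrightarrow> dir_deriv v (piece g l u k) = (\<lambda>x. l * piece (dir_deriv v g) l u k x)"
  unfolding piece_def[abs_def] by (rule dir_deriv_scaleR_shift)

lemma iter_deriv_piece:
  assumes "smooth g"
  shows "iter_deriv ws (piece g l u k) = (\<lambda>x. l ^ length ws * piece (iter_deriv ws g) l u k x)"
proof (induction ws)
  case (Cons w ws)
  have "smooth (iter_deriv ws g)" by (rule smooth_iter_deriv[OF assms])
  then show ?case
    by (simp add: Cons.IH dir_deriv_cmult[OF smooth_piece] dir_deriv_piece mult_ac)
qed simp

text \<open>Derivatives of a spread are again spreads, with one factor \<open>l\<close> per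
  differentiation, so a single norm formula covers every term of the Sobolev norm.\<close>

lemma iter_deriv_spread:
  assumes "smooth g"
  shows "iter_deriv ws (spread g l u n s) =
    (\<lambda>x. l ^ length ws * spread (iter_deriv ws g) l u n s x)"
proof -
  have "iter_deriv ws (spread g l u n s) =
      (\<lambda>x. \<Sum>j<n. l ^ DIM('a) / real n * iter_deriv ws (piece g l u (s j)) x)"
  proof (induction ws)
    case (Cons w ws)
    have *: "smooth (iter_deriv ws (piece g l u k))" for k
      by (intro smooth_iter_deriv smooth_piece assms)
    have "iter_deriv (w # ws) (spread g l u n s) =
        dir_deriv w (\<lambda>x. \<Sum>j<n. l ^ DIM('a) / real n * iter_deriv ws (piece g l u (s j)) x)"
      by (simp only: foldr_Cons comp_apply Cons.IH)
    also have "\<dots> = (\<lambda>x. \<Sum>j<n. dir_deriv w (\<lambda>x. l ^ DIM('a) / real n * iter_deriv ws (piece g l u (s j)) x) x)"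
      by (intro dir_deriv_sum smooth_mult smooth_const *)
    finally show ?case by (simp only: dir_deriv_cmult[OF *] foldr_Cons comp_apply)
  qed (simp add: spread_def[abs_def])
  then show ?thesis
    by (simp add: iter_deriv_piece[OF assms] spread_def sum_distrib_left mult_ac)
qed

text \<open>Each derivative enlarges the support at most to its closure, which a closed
  \<open>C\<close> absorbs. Applied to the cube, it keeps the pieces of a derivative inside their
  strips.\<close>

lemma support_iter_deriv:
  assumes "closed C" "\<And>x. g x \<noteq> 0 \<Longrightarrow> x \<in> C" "iter_deriv ws g x \<noteq> 0"
  shows "x \<in> C"
  using assms(3)
proof (induction ws arbitrary: x)
  case (Cons w ws)
  have "x \<in> closure {x. iter_deriv ws g x \<noteq> 0}"
    using dir_deriv_support[of w "iter_deriv ws g"] Cons.prems by auto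
  also have "\<dots> \<subseteq> C"
    using Cons.IH by (intro closure_minimal assms(1)) auto
  finally show ?case .
qed (use assms(2) in simp)

section \<open>Lebesgue and Sobolev norms of spread-out densities\<close>

lemma abs_spread_powr:
  fixes g :: "'v::euclidean_space \<Rightarrow> real"
  assumes "\<And>x. g x \<noteq> 0 \<Longrightarrow> x \<in> cbox (- One) One" "u \<in> Basis" "l > 0" "inj_on s {..<n}"
  shows "\<bar>spread g l u n s x\<bar> powr p =
    (\<Sum>j<n. (l ^ DIM('v) / real n) powr p * \<bar>piece g l u (s j) x\<bar> powr p)"
proof -
  have "\<bar>spread g l u n s x\<bar> powr p = (\<Sum>j<n. \<bar>l ^ DIM('v) / real n * piece g l u (s j) x\<bar> powr p)"
    unfolding spread_def
  proof (rule powr_sum_disjoint)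
    fix i j assume ij: "i \<in> {..<n}" "j \<in> {..<n}"
      and "l ^ DIM('v) / real n * piece g l u (s i) x \<noteq> 0"
        "l ^ DIM('v) / real n * piece g l u (s j) x \<noteq> 0"
    then have "x \<in> strip l u (s i)" "x \<in> strip l u (s j)"
      using piece_eq_0[OF assms(1-3)] by (metis mult_zero_right)+
    then have "s i = s j" by (rule strip_unique)
    then show "i = j" using assms(4) ij by (auto dest: inj_onD)
  qed simp
  moreover have "\<bar>l ^ DIM('v) / real n * y\<bar> powr p = (l ^ DIM('v) / real n) powr p * \<bar>y\<bar> powr p" for y
    unfolding abs_mult using assms(3) by (subst powr_mult) simp_all
  ultimately show ?thesis by (simp only:)
qed

lemma abs_powr_measurable:
  "g \<in> borel_measurable borel \<Longrightarrow> (\<lambda>x. \<bar>g x\<bar> powr p) \<in> borel_measurable borel" for g :: "_ \<Rightarrow> real"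
  by measurable

lemma test_function_powr_integrable:
  assumes "test_function g" "p > 0"
  shows "integrable lborel (\<lambda>x. \<bar>g x\<bar> powr p)"
proof -
  let ?K = "closure {x. g x \<noteq> 0}"
  have "integrable lborel (\<lambda>x. indicator ?K x *\<^sub>R \<bar>g x\<bar> powr p)"
  proof (rule borel_integrable_compact)
    show "compact ?K" using assms by (simp add: test_function_def)
    have "continuous_on ?K g"
      using assms by (auto simp: test_function_iff intro: continuous_on_subset smooth_continuous)
    then show "continuous_on ?K (\<lambda>x. \<bar>g x\<bar> powr p)"
      using assms(2) by (intro continuous_on_powr' continuous_intros) auto
  qed
  also have "(\<lambda>x. indicator ?K x *\<^sub>R \<bar>g x\<bar> powr p) = (\<lambda>x. \<bar>g x\<bar> powr p)"
    using closure_subset[of "{x. g x \<noteq> 0}"] by (auto simp: fun_eq_iff indicator_def)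
  finally show ?thesis .
qed

lemma integral_abs_piece_powr:
  fixes g :: "'v::euclidean_space \<Rightarrow> real"
  assumes g: "g \<in> borel_measurable borel" and l: "l > 0"
  shows "(LINT x|lborel. \<bar>piece g l u k x\<bar> powr p) =
    l powr (- real DIM('v)) * (LINT x|lborel. \<bar>g x\<bar> powr p)"
  using integral_scaleR_shift[OF l abs_powr_measurable[OF g, of p], of "(3 * real k / l) *\<^sub>R u"] l
  by (simp add: piece_def powr_minus powr_realpow field_simps)

text \<open>Each of the \<open>n\<close> disjoint pieces has height of order
  \<open>l powr d / n\<close> on a volume of order \<open>l powr (- d)\<close>. The p-th powers add
  up to \<open>n * (l powr d / n) powr p * l powr (- d)\<close> times a constant, and the p-th root
  gives the exponents.\<close>

lemma Lp_norm_spread: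
  fixes g :: "'v::euclidean_space \<Rightarrow> real"
  assumes g: "test_function g" and supp: "\<And>x. g x \<noteq> 0 \<Longrightarrow> x \<in> cbox (- One) One"
    and u: "u \<in> Basis" and l: "l > 0" and s: "inj_on s {..<n}" and n: "n > 0" and p: "p > 0"
  shows "Lp_norm p (spread g l u n s) =
    real n powr (1 / p - 1) * l powr (real DIM('v) - real DIM('v) / p) * Lp_norm p g"
proof -
  define d where "d = real DIM('v)"
  define J where "J = (LINT x|lborel. \<bar>g x\<bar> powr p)"
  have J: "J \<ge> 0" unfolding J_def by (intro Bochner_Integration.integral_nonneg) auto
  have ld: "l ^ DIM('v) = l powr d" using l by (simp add: d_def powr_realpow)
  have gm: "g \<in> borel_measurable borel" using g by (simp add: test_function_iff smooth_borel_measurable)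
  have pc: "(LINT x|lborel. \<bar>piece g l u k x\<bar> powr p) = l powr (- d) * J" for k
    unfolding d_def J_def by (rule integral_abs_piece_powr[OF gm l])
  have "\<bar>spread g l u n s x\<bar> powr p =
      (\<Sum>j<n. (l powr d / real n) powr p * \<bar>piece g l u (s j) x\<bar> powr p)" for x
    using abs_spread_powr[of g u l s n x p] supp u l s ld by simp
  then have "(LINT x|lborel. \<bar>spread g l u n s x\<bar> powr p) =
      (\<Sum>j<n. LINT x|lborel. (l powr d / real n) powr p * \<bar>piece g l u (s j) x\<bar> powr p)"
    by (simp only:) (intro Bochner_Integration.integral_sum integrable_mult_right test_function_powr_integrable
        test_function_piece g l p)
  also have "\<dots> = real n * ((l powr d / real n) powr p * (l powr (- d) * J))"
    by (simp add: pc)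
  finally have "Lp_norm p (spread g l u n s) =
      (real n * ((l powr d / real n) powr p * (l powr (- d) * J))) powr (1 / p)"
    by (simp add: Lp_norm_def)
  also have "\<dots> = real n powr (1 / p) * ((l powr d / real n) * (l powr (- d / p) * J powr (1 / p)))"
    using J n l p by (simp add: powr_mult powr_powr)
  also have "\<dots> = (real n powr (1 / p) / real n) * (l powr d * l powr (- d / p)) * J powr (1 / p)"
    by simp
  also have "\<dots> = real n powr (1 / p - 1) * l powr (d - d / p) * J powr (1 / p)"
    using n by (simp add: powr_diff powr_add[symmetric])
  finally show ?thesis by (simp add: Lp_norm_def J_def d_def)
qed

lemma Lp_norm_cmult: "c \<ge> 0 \<Longrightarrow> p > 0 \<Longrightarrow> Lp_norm p (\<lambda>x. c * g x) = c * Lp_norm p g"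
  unfolding Lp_norm_def by (simp add: abs_mult powr_mult powr_powr)

text \<open>Reduces membership in the ball to a numerical inequality in \<open>l\<close> and
  \<open>n\<close>. The constants \<open>A\<close> are norms of fixed classical derivatives of
  \<open>\<psi>\<close>, chosen before \<open>l\<close>, \<open>n\<close>, \<open>s\<close> and
  \<open>r\<close>. The value at the zero multi-indices is exposed because the case
  \<open>p = 1\<close> needs it exactly.\<close>

lemma spread_in_mixed_sobolev_ball:
  fixes \<psi> :: "(real ^ 'd1::finite) \<times> (real ^ 'd2::finite) \<Rightarrow> real" and p :: real
  defines "d \<equiv> real (CARD('d1) + CARD('d2))"
  assumes \<psi>: "test_function \<psi>" and supp: "\<And>x. \<psi> x \<noteq> 0 \<Longrightarrow> x \<in> cbox (- One) One"
    and u: "u \<in> Basis" and p: "p > 0"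
  obtains A :: "('d1 \<Rightarrow> nat) \<Rightarrow> ('d2 \<Rightarrow> nat) \<Rightarrow> real" where
    "\<And>\<alpha> \<beta>. A \<alpha> \<beta> \<ge> 0" "A (\<lambda>_. 0) (\<lambda>_. 0) = Lp_norm p \<psi>"
    "\<And>l n s s1 s2 r. l > 0 \<Longrightarrow> n > 0 \<Longrightarrow> inj_on s {..<n} \<Longrightarrow>
      (\<Sum>\<alpha> | order_of \<alpha> \<le> s1. \<Sum>\<beta> | order_of \<beta> \<le> s2. real n powr (1 / p - 1) *
        l powr (real (order_of \<alpha> + order_of \<beta>) + d - d / p) * A \<alpha> \<beta>) \<le> r \<Longrightarrow>
      spread \<psi> l u n s \<in> mixed_sobolev_ball s1 s2 p r"
proof -
  \<comment> \<open>All facts about one list are bundled so that choice yields a single family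
    \<open>W\<close> over all pairs of multi-indices.\<close>
  define P where "P \<alpha> \<beta> ws \<longleftrightarrow> length ws = order_of \<alpha> + order_of \<beta> \<and>
    (\<forall>f. test_function f \<longrightarrow> (\<exists>g. has_weak_deriv dir1 \<alpha> f g) \<and>
      (\<exists>h. has_weak_deriv dir2 \<beta> (weak_deriv dir1 \<alpha> f) h) \<and>
      weak_deriv dir2 \<beta> (weak_deriv dir1 \<alpha> f) \<in> borel_measurable borel \<and>
      (AE x in lborel. weak_deriv dir2 \<beta> (weak_deriv dir1 \<alpha> f) x = iter_deriv ws f x))"
    for \<alpha> :: "'d1 \<Rightarrow> nat" and \<beta> :: "'d2 \<Rightarrow> nat" and ws
  have "\<exists>ws. P \<alpha> \<beta> ws" for \<alpha> \<beta>
  proof (rule mixed_weak_deriv_test_function[of \<alpha> \<beta> dir1 dir2])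
    fix ws
    assume "length ws = order_of \<alpha> + order_of \<beta>"
      "\<And>f :: (real ^ 'd1) \<times> (real ^ 'd2) \<Rightarrow> real. test_function f \<Longrightarrow> \<exists>g. has_weak_deriv dir1 \<alpha> f g"
      "\<And>f. test_function f \<Longrightarrow> \<exists>h. has_weak_deriv dir2 \<beta> (weak_deriv dir1 \<alpha> f) h"
      "\<And>f. test_function f \<Longrightarrow> weak_deriv dir2 \<beta> (weak_deriv dir1 \<alpha> f) \<in> borel_measurable borel"
      "\<And>f. test_function f \<Longrightarrow>
        AE x in lborel. weak_deriv dir2 \<beta> (weak_deriv dir1 \<alpha> f) x = iter_deriv ws f x"
    then have "P \<alpha> \<beta> ws" unfolding P_def by (intro conjI allI impI) simp_all
    then show ?thesis by blast
  qed
  then obtain W where PW: "\<And>\<alpha> \<beta>. P \<alpha> \<beta> (W \<alpha> \<beta>)"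
    by metis
  have W: "length (W \<alpha> \<beta>) = order_of \<alpha> + order_of \<beta>"
    "\<And>f :: (real ^ 'd1) \<times> (real ^ 'd2) \<Rightarrow> real. test_function f \<Longrightarrow> \<exists>g. has_weak_deriv dir1 \<alpha> f g"
    "\<And>f. test_function f \<Longrightarrow> \<exists>h. has_weak_deriv dir2 \<beta> (weak_deriv dir1 \<alpha> f) h"
    "\<And>f. test_function f \<Longrightarrow> weak_deriv dir2 \<beta> (weak_deriv dir1 \<alpha> f) \<in> borel_measurable borel"
    "\<And>f. test_function f \<Longrightarrow>
      AE x in lborel. weak_deriv dir2 \<beta> (weak_deriv dir1 \<alpha> f) x = iter_deriv (W \<alpha> \<beta>) f x"
    for \<alpha> \<beta>
    using PW[of \<alpha> \<beta>] unfolding P_def by simp_all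
  define A where "A \<alpha> \<beta> = Lp_norm p (iter_deriv (W \<alpha> \<beta>) \<psi>)" for \<alpha> \<beta>
  show ?thesis
  proof (rule that[of A])
    show "A \<alpha> \<beta> \<ge> 0" for \<alpha> \<beta> by (simp add: A_def Lp_norm_def)
    have "W (\<lambda>_. 0) (\<lambda>_. 0) = []"
      using W(1)[of "\<lambda>_. 0" "\<lambda>_. 0"] by (simp add: order_of_def)
    then show "A (\<lambda>_. 0) (\<lambda>_. 0) = Lp_norm p \<psi>" by (simp add: A_def)
    fix l r :: real and n s1 s2 :: nat and s :: "nat \<Rightarrow> nat"
    assume l: "l > 0" and n: "n > 0" and s: "inj_on s {..<n}"
      and le: "(\<Sum>\<alpha> | order_of \<alpha> \<le> s1. \<Sum>\<beta> | order_of \<beta> \<le> s2. real n powr (1 / p - 1) *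
        l powr (real (order_of \<alpha> + order_of \<beta>) + d - d / p) * A \<alpha> \<beta>) \<le> r"
    let ?f = "spread \<psi> l u n s"
    have f: "test_function ?f" by (rule test_function_spread[OF \<psi> l])
    have sm: "smooth \<psi>" using \<psi> by (simp add: test_function_iff)
    have Wf[measurable]: "iter_deriv (W \<alpha> \<beta>) ?f \<in> borel_measurable borel" for \<alpha> \<beta>
      using test_function_iter_deriv[OF f] by (simp add: test_function_iff smooth_borel_measurable)
    note [measurable] = W(4)[OF f]
    have AE: "AE x in lborel. \<bar>weak_deriv dir2 \<beta> (weak_deriv dir1 \<alpha> ?f) x\<bar> powr p =
        \<bar>iter_deriv (W \<alpha> \<beta>) ?f x\<bar> powr p" for \<alpha> \<beta>
      using W(5)[OF f, of \<beta> \<alpha>] by eventually_elim simp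
    have norm: "Lp_norm p (weak_deriv dir2 \<beta> (weak_deriv dir1 \<alpha> ?f)) = real n powr (1 / p - 1) *
        l powr (real (order_of \<alpha> + order_of \<beta>) + d - d / p) * A \<alpha> \<beta>" for \<alpha> \<beta>
    proof -
      have "Lp_norm p (weak_deriv dir2 \<beta> (weak_deriv dir1 \<alpha> ?f)) = Lp_norm p (iter_deriv (W \<alpha> \<beta>) ?f)"
        unfolding Lp_norm_def using AE by (intro arg_cong[where f = "\<lambda>z. z powr (1 / p)"] integral_cong_AE) auto
      also have "\<dots> = l ^ length (W \<alpha> \<beta>) * Lp_norm p (spread (iter_deriv (W \<alpha> \<beta>) \<psi>) l u n s)"
        unfolding iter_deriv_spread[OF sm] using l p by (intro Lp_norm_cmult) auto
      also have "Lp_norm p (spread (iter_deriv (W \<alpha> \<beta>) \<psi>) l u n s) =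
          real n powr (1 / p - 1) * l powr (d - d / p) * A \<alpha> \<beta>"
        unfolding A_def d_def
        by (subst Lp_norm_spread[OF test_function_iter_deriv[OF \<psi>] support_iter_deriv[OF closed_cbox supp] u l s n p])
          auto
      also have "l ^ length (W \<alpha> \<beta>) = l powr real (order_of \<alpha> + order_of \<beta>)"
        using W(1) powr_realpow[OF l, of "order_of \<alpha> + order_of \<beta>"] by simp
      finally show ?thesis
        using l by (simp add: powr_add powr_diff)
    qed
    have "weak_deriv dir2 \<beta> (weak_deriv dir1 \<alpha> ?f) \<in> Lp_space p" for \<alpha> \<beta>
    proof -
      have "integrable lborel (\<lambda>x. \<bar>weak_deriv dir2 \<beta> (weak_deriv dir1 \<alpha> ?f) x\<bar> powr p) \<longleftrightarrow>
          integrable lborel (\<lambda>x. \<bar>iter_deriv (W \<alpha> \<beta>) ?f x\<bar> powr p)"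
        using AE by (intro integrable_cong_AE) auto
      then show ?thesis
        using test_function_powr_integrable[OF test_function_iter_deriv[OF f] p] W(4)[OF f]
        by (simp add: Lp_space_def)
    qed
    then have "?f \<in> mixed_sobolev_space s1 s2 p"
      using W(2)[OF f] W(3)[OF f] unfolding mixed_sobolev_space_def by blast
    moreover have "mixed_sobolev_norm s1 s2 p ?f \<le> r"
      using le unfolding mixed_sobolev_norm_def norm .
    ultimately show "?f \<in> mixed_sobolev_ball s1 s2 p r"
      by (simp add: mixed_sobolev_ball_def)
  qed
qed

section \<open>Total mass of spread-out densities\<close>

lemma nn_integral_piece:
  fixes \<psi> :: "'v::euclidean_space \<Rightarrow> real"
  assumes \<psi>: "prob_density \<psi>" and l: "l > 0"
  shows "(\<integral>\<^sup>+x. ennreal (l ^ DIM('v) / real n * piece \<psi> l u k x) \<partial>lborel) = ennreal (1 / real n)"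
proof -
  have [measurable]: "\<psi> \<in> borel_measurable borel" using \<psi> by (simp add: prob_density_def)
  have [measurable]: "piece \<psi> l u k \<in> borel_measurable borel" by (rule piece_measurable) simp
  have "(\<integral>\<^sup>+x. ennreal (l ^ DIM('v) / real n * piece \<psi> l u k x) \<partial>lborel) =
      (\<integral>\<^sup>+x. ennreal (1 / real n) * (ennreal (l ^ DIM('v)) * ennreal (piece \<psi> l u k x)) \<partial>lborel)"
    using l by (intro nn_integral_cong) (simp add: ennreal_mult'[symmetric])
  also have "\<dots> = ennreal (1 / real n) * (ennreal (l ^ DIM('v)) * (\<integral>\<^sup>+x. ennreal (piece \<psi> l u k x) \<partial>lborel))"
    by (simp add: nn_integral_cmult)
  also have "ennreal (l ^ DIM('v)) * (\<integral>\<^sup>+x. ennreal (piece \<psi> l u k x) \<partial>lborel) = 1"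
    using nn_integral_scaleR_shift[OF l, of "\<lambda>x. ennreal (\<psi> x)"] \<psi>
    by (simp add: piece_def prob_density_def)
  finally show ?thesis by simp
qed

lemma sum_ennreal_inverse:
  assumes "finite I"
  shows "(\<Sum>i\<in>I. ennreal (1 / real n)) = ennreal (real (card I) / real n)"
  using assms by (subst sum_ennreal) auto

lemma prob_density_spread:
  fixes \<psi> :: "'v::euclidean_space \<Rightarrow> real"
  assumes \<psi>: "prob_density \<psi>" and l: "l > 0" and n: "n > 0"
  shows "prob_density (spread \<psi> l u n s)"
proof -
  have [measurable]: "\<psi> \<in> borel_measurable borel" using \<psi> by (simp add: prob_density_def)
  have [measurable]: "piece \<psi> l u k \<in> borel_measurable borel" for k by (rule piece_measurable) simp
  have nn: "0 \<le> l ^ DIM('v) / real n * piece \<psi> l u k x" for k x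
    using \<psi> l by (simp add: prob_density_def piece_def)
  have "(\<integral>\<^sup>+x. ennreal (spread \<psi> l u n s x) \<partial>lborel) =
      (\<integral>\<^sup>+x. (\<Sum>j<n. ennreal (l ^ DIM('v) / real n * piece \<psi> l u (s j) x)) \<partial>lborel)"
    unfolding spread_def by (intro nn_integral_cong sum_ennreal[symmetric] nn)
  also have "\<dots> = (\<Sum>j<n. ennreal (1 / real n))"
    by (subst nn_integral_sum) (simp_all only: nn_integral_piece[OF \<psi> l], measurable)
  also have "\<dots> = 1"
    using n by (subst sum_ennreal_inverse) auto
  finally have "(\<integral>\<^sup>+x. ennreal (spread \<psi> l u n s x) \<partial>lborel) = 1" .
  moreover have "spread \<psi> l u n s \<in> borel_measurable borel"
    unfolding spread_def[abs_def] by measurable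
  moreover have "0 \<le> spread \<psi> l u n s x" for x
    unfolding spread_def by (intro sum_nonneg nn)
  ultimately show ?thesis
    unfolding prob_density_def by blast
qed

lemma ennreal_divide_le_of_le_mult:
  assumes "c > 0" "ennreal x \<le> ennreal c * B"
  shows "ennreal (x / c) \<le> B"
proof (cases B)
  case (real b)
  then have "x \<le> c * b"
    using assms by (simp add: ennreal_mult'[symmetric] ennreal_le_iff)
  then show ?thesis
    using real assms(1) by (simp add: ennreal_le_iff field_simps)
qed simp

section \<open>Lower bound for the minimax risk\<close>

text \<open>Cell \<open>j\<close> is a pair of adjacent strips, \<open>2 * j\<close> and
  \<open>2 * j + 1\<close>, and \<open>\<theta>\<close> decides which of them carries the bump. The
  hypercube bound is then applied with \<open>m = n\<close> and \<open>q = 1 - 1 / n\<close>, since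
  every cell has mass \<open>1 / n\<close> whatever \<open>\<theta>\<close> is.\<close>

lemma minimax_risk_spread:
  fixes \<psi> :: "'v::euclidean_space \<Rightarrow> real"
  assumes \<psi>: "test_function \<psi>" "prob_density \<psi>"
    and supp: "\<And>x. \<psi> x \<noteq> 0 \<Longrightarrow> x \<in> cbox (- One) One"
    and u: "u \<in> Basis" and l: "l > 0" and n: "n > 0" and p: "p > 0"
    and F: "\<And>s. inj_on s {..<n} \<Longrightarrow> spread \<psi> l u n s \<in> F"
  shows "ennreal (real n * ((1 - 1 / real n) ^ n * ((l ^ DIM('v) / real n) powr p *
      (l powr (- real DIM('v)) * (LINT x|lborel. \<bar>\<psi> x\<bar> powr p)))) / (2 powr p * 2))
    \<le> minimax_risk p n F"
proof -
  let ?c = "l ^ DIM('v) / real n"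
  define flip where "flip j \<theta> = (if j \<in> \<theta> then \<theta> - {j} else insert j \<theta>)" for j :: nat and \<theta>
  define pos where "pos \<theta> j = 2 * j + (if j \<in> \<theta> then 1 else 0)" for j :: nat and \<theta>
  define f where "f \<theta> = spread \<psi> l u n (pos \<theta>)" for \<theta>
  define C where "C j = strip l u (2 * j) \<union> strip l u (2 * j + 1)" for j
  define \<delta> where "\<delta> = ?c powr p * (l powr (- real DIM('v)) * (LINT x|lborel. \<bar>\<psi> x\<bar> powr p))"
  have pos_cases: "pos \<theta> j = 2 * j \<or> pos \<theta> j = 2 * j + 1" for \<theta> j
    by (auto simp: pos_def)
  \<comment> \<open>Integer division by 2 recovers \<open>j\<close> from its position.\<close>
  have pos_inj: "inj_on (pos \<theta>) I" for \<theta> I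
    by (rule inj_onI) (metis pos_cases add_right_cancel div_mult_self1_is_m double_not_eq_Suc_double
        mult_cancel1 Suc_eq_plus1 zero_neq_numeral)
  have [measurable]: "\<psi> \<in> borel_measurable borel" using \<psi> by (simp add: prob_density_def)
  have [measurable]: "piece \<psi> l u k \<in> borel_measurable borel" for k by (rule piece_measurable) simp
  have Cm[measurable]: "C j \<in> sets borel" for j
    unfolding C_def by (intro sets.Un strip_measurable)
  have z: "piece \<psi> l u k x = 0" if "x \<notin> strip l u k" for k x
    using piece_eq_0[OF supp u l that] by blast
  have in_C: "x \<in> C j" if "x \<in> strip l u (pos \<theta> j)" for x \<theta> j
    using that pos_cases[of \<theta> j] by (auto simp: C_def)
  have C_unique: "i = j" if "x \<in> C i" "x \<in> C j" for x i j
  proof -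
    from that obtain a b where ab: "a = 2 * i \<or> a = 2 * i + 1" "x \<in> strip l u a"
      "b = 2 * j \<or> b = 2 * j + 1" "x \<in> strip l u b"
      unfolding C_def by blast
    then have "a = b" by (blast intro: strip_unique)
    with ab(1,3) show ?thesis by presburger
  qed
  have nn: "0 \<le> ?c * piece \<psi> l u k x" for k x
    using \<psi>(2) l by (simp add: prob_density_def piece_def)
  have f_eq: "f \<theta> x = ?c * piece \<psi> l u (pos \<theta> j) x" if x: "x \<in> C j" and j: "j < n" for \<theta> x j
  proof -
    have "piece \<psi> l u (pos \<theta> i) x = 0" if "i \<noteq> j" for i
      using in_C C_unique x that by (intro z) blast
    then have "(\<Sum>i<n. ?c * piece \<psi> l u (pos \<theta> i) x) = (\<Sum>i<n. if i = j then ?c * piece \<psi> l u (pos \<theta> j) x else 0)"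
      by (intro sum.cong) auto
    then show ?thesis using j by (simp add: f_def spread_def)
  qed
  \<comment> \<open>Removing cell \<open>j\<close> deletes exactly the summand \<open>j\<close>: on
    the cell no other piece lives, and off the cell this piece vanishes. The mass outside the cell
    is then \<open>n - 1\<close> times \<open>1 / n\<close>.\<close>
  have off: "f \<theta> x * indicator (- C j) x = (\<Sum>i\<in>{..<n} - {j}. ?c * piece \<psi> l u (pos \<theta> i) x)"
    if "j < n" for \<theta> x j
  proof (cases "x \<in> C j")
    case True
    have "?c * piece \<psi> l u (pos \<theta> i) x = 0" if "i \<in> {..<n} - {j}" for i
      using in_C C_unique True that z by (metis Diff_iff insertI1 mult_zero_right)
    then have "(\<Sum>i\<in>{..<n} - {j}. ?c * piece \<psi> l u (pos \<theta> i) x) = 0"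
      by (rule sum.neutral[OF ballI])
    with True show ?thesis by simp
  next
    case False
    then have "piece \<psi> l u (pos \<theta> j) x = 0" using in_C z by blast
    with False that show ?thesis by (simp add: f_def spread_def sum.remove[of "{..<n}" j])
  qed
  have mass: "emeasure (density lborel (\<lambda>x. ennreal (f \<theta> x))) (- C j) = ennreal (1 - 1 / real n)"
    if j: "j < n" for \<theta> j
  proof -
    have [measurable]: "f \<theta> \<in> borel_measurable borel"
      unfolding f_def spread_def[abs_def] by measurable
    have "emeasure (density lborel (\<lambda>x. ennreal (f \<theta> x))) (- C j) =
        (\<integral>\<^sup>+x. ennreal (f \<theta> x * indicator (- C j) x) \<partial>lborel)"
      using borel_comp[OF Cm] by (subst emeasure_density) (auto intro!: nn_integral_cong simp: indicator_def)
    also have "\<dots> = (\<integral>\<^sup>+x. (\<Sum>i\<in>{..<n} - {j}. ennreal (?c * piece \<psi> l u (pos \<theta> i) x)) \<partial>lborel)"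
      unfolding off[OF j] by (intro nn_integral_cong sum_ennreal[symmetric] nn)
    also have "\<dots> = (\<Sum>i\<in>{..<n} - {j}. ennreal (1 / real n))"
      by (subst nn_integral_sum) (simp_all only: nn_integral_piece[OF \<psi>(2) l], measurable)
    also have "\<dots> = ennreal (real (n - 1) / real n)"
      using j by (subst sum_ennreal_inverse) auto
    finally show ?thesis using n by (simp add: of_nat_diff diff_divide_distrib)
  qed
  \<comment> \<open>Only the strip \<open>2 * j\<close> is counted: there one of the two densities
    carries the bump and the other is 0. The strip \<open>2 * j + 1\<close> would contribute the
    same amount again.\<close>
  have sep: "ennreal \<delta> \<le> local_loss p (C j) (f \<theta>) (f (flip j \<theta>))" if j: "j < n" for j \<theta>
  proof -
    have eq: "\<bar>?c * piece \<psi> l u (2 * j) x\<bar> powr p = ?c powr p * \<bar>piece \<psi> l u (2 * j) x\<bar> powr p" for x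
      unfolding abs_mult using l by (subst powr_mult) simp_all
    have "ennreal \<delta> = ennreal (LINT x|lborel. \<bar>?c * piece \<psi> l u (2 * j) x\<bar> powr p)"
      unfolding eq \<delta>_def by (simp add: integral_abs_piece_powr[OF _ l])
    also have "\<dots> = (\<integral>\<^sup>+x. ennreal (\<bar>?c * piece \<psi> l u (2 * j) x\<bar> powr p) \<partial>lborel)"
      by (intro nn_integral_eq_integral[symmetric] test_function_powr_integrable p
          test_function_cmult test_function_piece \<psi> l) simp
    also have "\<dots> \<le> local_loss p (C j) (f \<theta>) (f (flip j \<theta>))"
      unfolding local_loss_def
    proof (rule nn_integral_mono)
      fix x
      show "ennreal (\<bar>?c * piece \<psi> l u (2 * j) x\<bar> powr p) \<le>
          ennreal (\<bar>f \<theta> x - f (flip j \<theta>) x\<bar> powr p) * indicator (C j) x"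
      proof (cases "x \<in> strip l u (2 * j)")
        case True
        then have x: "x \<in> C j" by (simp add: C_def)
        have "piece \<psi> l u (2 * j + 1) x = 0"
          using True strip_unique[of x l u "2 * j" "2 * j + 1"] by (intro z) auto
        then have "\<bar>f \<theta> x - f (flip j \<theta>) x\<bar> = \<bar>?c * piece \<psi> l u (2 * j) x\<bar>"
          unfolding f_eq[OF x j] by (cases "j \<in> \<theta>") (simp_all add: pos_def flip_def)
        with x show ?thesis by simp
      qed (simp add: z)
    qed
    finally show ?thesis .
  qed
  have agree: "f \<theta> x = f (flip j \<theta>) x" if "x \<notin> C j" for j \<theta> x
  proof -
    have "piece \<psi> l u (pos \<theta> i) x = piece \<psi> l u (pos (flip j \<theta>) i) x" for i
    proof (cases "i = j")
      case True
      then show ?thesis using that in_C z by metis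
    qed (simp add: pos_def flip_def)
    then show ?thesis by (simp add: f_def spread_def)
  qed
  show ?thesis
    unfolding minimax_risk_def
  proof (rule INF_greatest)
    fix T :: "(nat \<Rightarrow> 'v) \<Rightarrow> 'v \<Rightarrow> real" assume T: "T \<in> estimators n"
    let ?B = "SUP f\<in>{f \<in> F. prob_density f}. Lp_risk p n T f"
    have "of_nat n * (ennreal (1 - 1 / real n) ^ n * ennreal \<delta>) \<le> ennreal (2 powr p) * (2 * ?B)"
    proof (rule hypercube_bound[where f = f and C = C])
      show "disjoint_family_on C {..<n}"
        using C_unique by (auto simp: disjoint_family_on_def)
      show "prob_density (f \<theta>)" for \<theta>
        unfolding f_def by (rule prob_density_spread[OF \<psi>(2) l n])
      then show "Lp_risk p n T (f \<theta>) \<le> ?B" for \<theta>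
        using F[OF pos_inj, of \<theta>] by (intro SUP_upper) (simp add: f_def)
      show "f \<theta> x = f (if j \<in> \<theta> then \<theta> - {j} else insert j \<theta>) x" if "x \<notin> C j" for j \<theta> x
        using agree[OF that, of \<theta>] by (simp add: flip_def)
      show "ennreal \<delta> \<le> local_loss p (C j) (f \<theta>) (f (if j \<in> \<theta> then \<theta> - {j} else insert j \<theta>))"
        if "j < n" for j \<theta>
        using sep[OF that, of \<theta>] by (simp add: flip_def)
    qed (use T p Cm mass in auto)
    moreover have "of_nat n * (ennreal (1 - 1 / real n) ^ n * ennreal \<delta>) =
        ennreal (real n * ((1 - 1 / real n) ^ n * \<delta>))"
      using n by (simp add: ennreal_power ennreal_mult' ennreal_of_nat_eq_real_of_nat)
    moreover have "ennreal (2 powr p) * (2 * ?B) = ennreal (2 powr p * 2) * ?B"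
      by (simp add: ennreal_mult mult.assoc)
    ultimately show "ennreal (real n * ((1 - 1 / real n) ^ n * (?c powr p * (l powr - real DIM('v) *
        (LINT x|lborel. \<bar>\<psi> x\<bar> powr p)))) / (2 powr p * 2)) \<le> ?B"
      by (intro ennreal_divide_le_of_le_mult) (simp_all add: \<delta>_def)
  qed
qed

text \<open>The limit is \<open>exp (- 1)\<close>, which exceeds 1/4 because
  \<open>exp 1 \<le> 3\<close>.\<close>

lemma eventually_power_ge_quarter: "\<forall>\<^sub>F n in sequentially. (1 - 1 / real n) ^ n \<ge> 1 / 4"
proof -
  have "(\<lambda>n. (1 + (- 1) / real n) ^ n) \<longlonglongrightarrow> exp (- 1)"
    by (rule tendsto_exp_limit_sequentially)
  moreover have "exp (- 1 :: real) > 1 / 4"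
    using exp_le by (simp add: exp_minus field_simps)
  ultimately have "\<forall>\<^sub>F n in sequentially. (1 + (- 1) / real n) ^ n > 1 / 4"
    by (rule order_tendstoD)
  then show ?thesis by eventually_elim simp
qed

text \<open>A sum over an infinite set is 0 by default; finiteness makes it possible to isolate the
  zero multi-indices when \<open>p = 1\<close>.\<close>

lemma finite_order_of_le: "finite {\<alpha> :: 'i::finite \<Rightarrow> nat. order_of \<alpha> \<le> s}"
proof (rule finite_subset)
  have "\<alpha> i \<le> order_of \<alpha>" for \<alpha> :: "'i \<Rightarrow> nat" and i
    unfolding order_of_def by (rule member_le_sum) auto
  then show "{\<alpha> :: 'i \<Rightarrow> nat. order_of \<alpha> \<le> s} \<subseteq> (\<Pi>\<^sub>E i\<in>UNIV. {..s})"
    by (auto intro: order_trans)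
  show "finite (\<Pi>\<^sub>E i\<in>(UNIV :: 'i set). {..s})"
    by (intro finite_PiE) auto
qed

text \<open>After taking logarithms both sides are linear in \<open>ln r\<close>,
  \<open>ln n\<close> and \<open>ln A\<close>. The two contributions of \<open>ln r\<close> cancel,
  and the coefficient of \<open>ln n\<close> is \<open>(p - 1) * (K / K - 1)\<close>, so only a
  power of \<open>A\<close> is left.\<close>

lemma rate_exponent_identity:
  fixes S D p A r n l K :: real
  assumes S: "S > 0" and D: "D > 0" and p: "p \<ge> 1" and A: "A > 0" and r: "r > 0" and n: "n > 0"
    and K: "K = S * p + D * (p - 1)"
    and l: "l = (r * n powr (1 - 1 / p) / A) powr (p / K)"
  shows "(r powr (D / S) / n) powr (- (S * (p - 1) * p / K)) * (n powr (1 - p) * l powr (D * (p - 1))) =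
    A powr (- (p * D * (p - 1) / K))"
proof -
  have K0: "K > 0" using K S D p by (auto intro: add_pos_nonneg)
  let ?lr = "ln r" and ?ln = "ln n" and ?lA = "ln A"
  have l0: "l > 0" using l r n A by simp
  have lnl: "ln l = p / K * (?lr + (1 - 1 / p) * ?ln - ?lA)"
    using r n A by (simp add: l ln_mult ln_div ln_powr)
  have "(r powr (D / S) / n) powr (- (S * (p - 1) * p / K)) * (n powr (1 - p) * l powr (D * (p - 1))) =
      exp (- (S * (p - 1) * p / K) * (D / S * ?lr - ?ln) + ((1 - p) * ?ln + D * (p - 1) * ln l))"
  proof -
    have "ln (r powr (D / S) / n) = D / S * ?lr - ?ln"
      using r n by (simp add: ln_div ln_powr)
    moreover have "x powr a * (y powr b * z powr c) = exp (a * ln x + (b * ln y + c * ln z))"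
      if "x > 0" "y > 0" "z > 0" for x y z a b c :: real
      using that by (simp add: powr_def exp_add)
    ultimately show ?thesis using r n l0 by simp
  qed
  also have "- (S * (p - 1) * p / K) * (D / S * ?lr - ?ln) + ((1 - p) * ?ln + D * (p - 1) * ln l) =
      - (p * D * (p - 1) / K) * ?lA + (p - 1) * ?ln * ((S * p + D * (p - 1)) / K - 1)"
    unfolding lnl using S K0 p by (simp add: field_simps)
  also have "(S * p + D * (p - 1)) / K - 1 = 0" using K0 by (simp add: K[symmetric])
  finally show ?thesis using A by (simp add: powr_def)
qed

theorem theorem3p9:
  fixes s1 s2 :: nat and p S D :: real
  assumes "s1 \<ge> 1" and "s2 \<ge> 1" and "1 \<le> p" and "p < 2"
    and "S = real (s1 + s2)"
    and "D = real (CARD('d1::finite) + CARD('d2::finite))"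
  shows "\<exists>c::real. c > 0 \<and>
    (\<forall>r rs :: real. r > 0 \<longrightarrow> (p = 1 \<longrightarrow> r > 1) \<longrightarrow> rs = (if p = 1 then r - 1 else r) \<longrightarrow>
      liminf (\<lambda>n::nat.
          ennreal ((rs powr (D / S) / real n) powr (- (S * (p - 1) * p / (S * p + D * (p - 1))))) *
          minimax_risk p n
            (mixed_sobolev_ball s1 s2 p r :: ((real ^ 'd1) \<times> (real ^ 'd2) \<Rightarrow> real) set))
        \<ge> ennreal c)"
proof -
  have p: "p > 0" using assms by simp
  have S: "S > 0" using assms by simp
  have D: "D > 0" using assms(6) by (simp add: add_pos_pos)
  define K where "K = S * p + D * (p - 1)"
  have K: "K > 0" using S D assms(3) by (auto simp: K_def intro!: add_pos_nonneg)
  obtain u :: "(real ^ 'd1) \<times> (real ^ 'd2)" where u: "u \<in> Basis"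
    using nonempty_Basis by blast
  obtain \<psi> :: "(real ^ 'd1) \<times> (real ^ 'd2) \<Rightarrow> real" where
    \<psi>: "test_function \<psi>" "prob_density \<psi>" and supp: "\<And>x. \<psi> x \<noteq> 0 \<Longrightarrow> x \<in> cbox (- One) One"
    using ex_base_bump by blast
  obtain A :: "('d1 \<Rightarrow> nat) \<Rightarrow> ('d2 \<Rightarrow> nat) \<Rightarrow> real" where
    A: "\<And>\<alpha> \<beta>. A \<alpha> \<beta> \<ge> 0" "A (\<lambda>_. 0) (\<lambda>_. 0) = Lp_norm p \<psi>" and
    ball: "\<And>l n s s1 s2 r. l > 0 \<Longrightarrow> n > 0 \<Longrightarrow> inj_on s {..<n} \<Longrightarrow>
      (\<Sum>\<alpha> | order_of \<alpha> \<le> s1. \<Sum>\<beta> | order_of \<beta> \<le> s2. real n powr (1 / p - 1) *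
        l powr (real (order_of \<alpha> + order_of \<beta>) + D - D / p) * A \<alpha> \<beta>) \<le> r \<Longrightarrow>
      spread \<psi> l u n s \<in> mixed_sobolev_ball s1 s2 p r"
  proof (rule spread_in_mixed_sobolev_ball[OF \<psi>(1) _ u p, folded assms(6)], goal_cases)
    case (1 x)
    show ?case by (rule supp[OF 1(2)])
  next
    case (2 A)
    show ?case by (rule 2(1)[of A, OF 2(2-4)])
  qed
  define J where "J = (LINT x|lborel. \<bar>\<psi> x\<bar> powr p)"
  \<comment> \<open>The summand 1 makes \<open>Am\<close> positive, so it can be divided by, and
    leaves room in the norm estimates, which produce \<open>Am - 1\<close>.\<close>
  define Am where "Am = 1 + (\<Sum>\<alpha> | order_of \<alpha> \<le> s1. \<Sum>\<beta> | order_of \<beta> \<le> s2. A \<alpha> \<beta>)"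
  have A_sum: "0 \<le> (\<Sum>\<alpha> | order_of \<alpha> \<le> s1. \<Sum>\<beta> | order_of \<beta> \<le> s2. A \<alpha> \<beta>)"
    by (intro sum_nonneg A)
  then have Am: "Am \<ge> 1" by (simp add: Am_def)
  have "J \<noteq> 0"
  proof
    assume "J = 0"
    then have "AE x in lborel. \<bar>\<psi> x\<bar> powr p = 0"
      unfolding J_def using test_function_powr_integrable[OF \<psi>(1) p]
      by (subst (asm) integral_nonneg_eq_0_iff_AE) auto
    then have "AE x in lborel. ennreal (\<psi> x) = 0"
      by eventually_elim simp
    then have "(\<integral>\<^sup>+x. ennreal (\<psi> x) \<partial>lborel) = (\<integral>\<^sup>+x. 0 \<partial>(lborel :: ((real ^ 'd1) \<times> (real ^ 'd2)) measure))"
      by (rule nn_integral_cong_AE)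
    then show False using \<psi>(2) by (simp add: prob_density_def)
  qed
  moreover have "J \<ge> 0" unfolding J_def by (intro Bochner_Integration.integral_nonneg) auto
  ultimately have J: "J > 0" by simp
  \<comment> \<open>The 8 combines the probability 1/4 of missing a cell with the 2 from pairing
    neighbours, \<open>2 powr p\<close> comes from the triangle inequality, and the power of
    \<open>Am\<close> is what survives in \<open>rate_exponent_identity\<close>.\<close>
  define c where "c = J / (8 * 2 powr p) * Am powr (- (p * D * (p - 1) / K))"
  have DIM: "real DIM((real ^ 'd1) \<times> (real ^ 'd2)) = D" using assms(6) by simp
  have risk: "ennreal (J / (8 * 2 powr p) * (real n powr (1 - p) * l powr (D * (p - 1))))
      \<le> minimax_risk p n (mixed_sobolev_ball s1 s2 p r :: ((real ^ 'd1) \<times> (real ^ 'd2) \<Rightarrow> real) set)"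
    if l: "l > 0" and n: "n > 0" and quarter: "(1 - 1 / real n) ^ n \<ge> 1 / 4"
      and le: "(\<Sum>\<alpha> | order_of \<alpha> \<le> s1. \<Sum>\<beta> | order_of \<beta> \<le> s2. real n powr (1 / p - 1) *
        l powr (real (order_of \<alpha> + order_of \<beta>) + D - D / p) * A \<alpha> \<beta>) \<le> r"
    for l r n
  proof -
    have ld: "l ^ DIM((real ^ 'd1) \<times> (real ^ 'd2)) = l powr D"
      unfolding DIM[symmetric] by (rule powr_realpow[OF l, symmetric])
    have "real n * ((l powr D / real n) powr p * l powr (- D)) =
        (real n * real n powr (- p)) * (l powr (D * p) * l powr (- D))"
      using l n by (simp add: powr_divide powr_powr powr_minus_divide)
    also have "\<dots> = real n powr (1 - p) * l powr (D * (p - 1))"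
      using n by (simp add: powr_add[symmetric] powr_mult_base algebra_simps)
    finally have eq: "real n * ((l powr D / real n) powr p * l powr (- D)) =
      real n powr (1 - p) * l powr (D * (p - 1))" .
    have "J / (8 * 2 powr p) * (real n powr (1 - p) * l powr (D * (p - 1))) =
        1 / 4 * (J / (2 powr p * 2) * (real n * ((l powr D / real n) powr p * l powr (- D))))"
      unfolding eq by simp
    also have "\<dots> \<le> (1 - 1 / real n) ^ n * (J / (2 powr p * 2) * (real n * ((l powr D / real n) powr p * l powr (- D))))"
      using J n by (intro mult_right_mono quarter mult_nonneg_nonneg) auto
    also have "\<dots> = real n * ((1 - 1 / real n) ^ n * ((l powr D / real n) powr p * (l powr (- D) * J))) / (2 powr p * 2)"
      by simp
    finally have "ennreal (J / (8 * 2 powr p) * (real n powr (1 - p) * l powr (D * (p - 1)))) \<le> ennreal \<dots>"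
      by (rule ennreal_leI)
    also have "\<dots> \<le> minimax_risk p n
        (mixed_sobolev_ball s1 s2 p r :: ((real ^ 'd1) \<times> (real ^ 'd2) \<Rightarrow> real) set)"
      using minimax_risk_spread[OF \<psi> supp u l n p ball[OF l n _ le]] unfolding J_def ld DIM by simp
    finally show ?thesis .
  qed
  show ?thesis
  proof (intro exI[of _ c] conjI allI impI)
    show "c > 0" using J Am by (simp add: c_def)
    fix r rs :: real
    assume r: "r > 0" "p = 1 \<longrightarrow> r > 1" and rs: "rs = (if p = 1 then r - 1 else r)"
    define E where "E = S * (p - 1) * p / K"
    \<comment> \<open>What remains is to find an admissible \<open>l\<close> for which rate times
      risk order is the constant appearing in \<open>c\<close>. The cases \<open>p = 1\<close> and
      \<open>p > 1\<close> differ only in this choice.\<close>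
    have "\<forall>\<^sub>F n in sequentially. \<exists>l>0.
      (\<Sum>\<alpha> | order_of \<alpha> \<le> s1. \<Sum>\<beta> | order_of \<beta> \<le> s2. real n powr (1 / p - 1) *
        l powr (real (order_of \<alpha> + order_of \<beta>) + D - D / p) * A \<alpha> \<beta>) \<le> r \<and>
      (rs powr (D / S) / real n) powr (- E) * (real n powr (1 - p) * l powr (D * (p - 1))) =
        Am powr (- (p * D * (p - 1) / K))"
    proof (cases "p = 1")
      case True
      \<comment> \<open>For \<open>p = 1\<close> the undifferentiated term is the total mass 1.
        Every other term carries a positive power of \<open>l \<le> 1\<close>, hence at most
        \<open>l\<close> itself, and together they contribute at most \<open>l * (Am - 1)\<close>,
        which must fit into \<open>r - 1\<close>.\<close>
      define l where "l = min 1 ((r - 1) / Am)"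
      have l: "l > 0" "l \<le> 1" "l * Am \<le> r - 1"
        using Am True r by (auto simp: l_def min_def field_simps)
      have A0: "A (\<lambda>_. 0) (\<lambda>_. 0) = 1"
      proof -
        have nonneg: "\<psi> x \<ge> 0" for x using \<psi>(2) unfolding prob_density_def by blast
        then have "ennreal (LINT x|lborel. \<psi> x) = (\<integral>\<^sup>+x. ennreal (\<psi> x) \<partial>lborel)"
          by (intro nn_integral_eq_integral[symmetric] test_function_integrable \<psi>(1)) simp
        then have "(LINT x|lborel. \<psi> x) = 1"
          using \<psi>(2) by (simp add: prob_density_def)
        moreover have "(LINT x|lborel. \<bar>\<psi> x\<bar> powr p) = (LINT x|lborel. \<psi> x)"
          using nonneg True by simp
        ultimately show ?thesis
          using True by (simp add: A(2) Lp_norm_def)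
      qed
      have "(\<Sum>\<alpha> | order_of \<alpha> \<le> s1. \<Sum>\<beta> | order_of \<beta> \<le> s2. real n powr (1 / p - 1) *
          l powr (real (order_of \<alpha> + order_of \<beta>) + D - D / p) * A \<alpha> \<beta>) \<le> r" if n: "n > 0" for n
      proof -
        \<comment> \<open>The test for both multi-indices being 0 is nested instead of a
          conjunction, so that the two sums collapse one after the other.\<close>
        have term_le: "real n powr (1 / p - 1) * l powr (real (order_of \<alpha> + order_of \<beta>) + D - D / p) * A \<alpha> \<beta>
            \<le> (if \<alpha> = (\<lambda>_. 0) then if \<beta> = (\<lambda>_. 0) then 1 else 0 else 0) + l * A \<alpha> \<beta>" for \<alpha> \<beta>
        proof (cases "\<alpha> = (\<lambda>_. 0) \<and> \<beta> = (\<lambda>_. 0)")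
          case T: True
          then show ?thesis using n l A0 True by (simp add: order_of_def)
        next
          case False
          then have "order_of \<alpha> + order_of \<beta> \<noteq> 0"
            by (simp add: order_of_def fun_eq_iff)
          then have "order_of \<alpha> + order_of \<beta> \<ge> 1" by linarith
          then have "l powr (real (order_of \<alpha> + order_of \<beta>)) \<le> l powr 1"
            using l by (intro powr_mono') auto
          then show ?thesis using False True n l A(1)[of \<alpha> \<beta>]
            by (auto simp: mult_right_mono)
        qed
        have "(\<Sum>\<alpha> | order_of \<alpha> \<le> s1. \<Sum>\<beta> | order_of \<beta> \<le> s2. real n powr (1 / p - 1) *
            l powr (real (order_of \<alpha> + order_of \<beta>) + D - D / p) * A \<alpha> \<beta>) \<le>
          (\<Sum>\<alpha> | order_of \<alpha> \<le> s1. \<Sum>\<beta> | order_of \<beta> \<le> s2.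
            (if \<alpha> = (\<lambda>_. 0) then if \<beta> = (\<lambda>_. 0) then 1 else 0 else 0) + l * A \<alpha> \<beta>)"
          by (intro sum_mono term_le)
        also have "\<dots> = (\<Sum>\<alpha>::'d1 \<Rightarrow> nat | order_of \<alpha> \<le> s1. if \<alpha> = (\<lambda>_. 0) then
            (\<Sum>\<beta>::'d2 \<Rightarrow> nat | order_of \<beta> \<le> s2. if \<beta> = (\<lambda>_. 0) then 1 else 0) else 0) + l * (Am - 1)"
          by (simp add: sum.distrib sum_distrib_left Am_def) (rule sum.cong, auto)
        also have "\<dots> = 1 + l * (Am - 1)"
        proof -
          have "order_of (\<lambda>_ :: 'd1. 0) = 0" "order_of (\<lambda>_ :: 'd2. 0) = 0"
            by (simp_all add: order_of_def)
          then show ?thesis by (simp add: finite_order_of_le)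
        qed
        also have "\<dots> \<le> r" using l by (simp add: algebra_simps)
        finally show ?thesis .
      qed
      \<comment> \<open>All outer exponents are 0 for \<open>p = 1\<close>. Since
        \<open>x powr 0 = 1\<close> only for nonzero \<open>x\<close>, this uses
        \<open>rs > 0\<close>, that is \<open>r > 1\<close>.\<close>
      moreover have "(rs powr (D / S) / real n) powr (- E) * (real n powr (1 - p) * l powr (D * (p - 1))) =
          Am powr (- (p * D * (p - 1) / K))" if "n > 0" for n
        using True r rs l that Am by (simp add: E_def)
      ultimately show ?thesis
        using l(1) by (intro eventually_mono[OF eventually_gt_at_top[of 0]] exI[of _ l] conjI)
    next
      case False
      then have p1: "p > 1" using assms(3) by simp
      have rs: "rs = r" using rs False by simp
      have a: "1 - 1 / p > 0" using p1 by simp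
      \<comment> \<open>From this threshold on \<open>b \<ge> 1\<close> and hence
        \<open>l \<ge> 1\<close>, so the largest power of \<open>l\<close>, attained at total order
        \<open>S\<close>, bounds all the others.\<close>
      define N where "N = (Am / r) powr (1 / (1 - 1 / p))"
      have "\<forall>\<^sub>F n in sequentially. real n \<ge> N"
        using filterlim_real_sequentially by (simp add: filterlim_at_top)
      with eventually_gt_at_top[of 0] show ?thesis
      proof eventually_elim
        case (elim n)
        \<comment> \<open>The Sobolev norm is at most \<open>real n powr (1 / p - 1) * l powr (K / p) * Am\<close>, which this \<open>l\<close>
          makes equal to \<open>r\<close>.\<close>
        define b where "b = r * real n powr (1 - 1 / p) / Am"
        define l where "l = b powr (p / K)"
        have "Am / r = N powr (1 - 1 / p)"
          using p1 Am r(1) by (simp add: N_def powr_powr)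
        also have "\<dots> \<le> real n powr (1 - 1 / p)"
          using elim a by (intro powr_mono2) (auto simp: N_def)
        finally have b: "b \<ge> 1" using Am r by (simp add: b_def field_simps)
        have l: "l \<ge> 1" unfolding l_def using b p K by (intro ge_one_powr_ge_zero) auto
        have KS: "K / p = S + D - D / p" using p by (simp add: K_def field_simps)
        have lK: "l powr (K / p) = b" using b p K by (simp add: l_def powr_powr)
        have term_le: "real n powr (1 / p - 1) * l powr (real (order_of \<alpha> + order_of \<beta>) + D - D / p) * A \<alpha> \<beta>
            \<le> real n powr (1 / p - 1) * b * A \<alpha> \<beta>" if "order_of \<alpha> \<le> s1" "order_of \<beta> \<le> s2" for \<alpha> \<beta>
        proof -
          have "l powr (real (order_of \<alpha> + order_of \<beta>) + D - D / p) \<le> l powr (K / p)"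
            unfolding KS assms(5) using l that by (intro powr_mono) auto
          then show ?thesis
            unfolding lK by (intro mult_right_mono mult_left_mono A) auto
        qed
        have "(\<Sum>\<alpha> | order_of \<alpha> \<le> s1. \<Sum>\<beta> | order_of \<beta> \<le> s2. real n powr (1 / p - 1) *
            l powr (real (order_of \<alpha> + order_of \<beta>) + D - D / p) * A \<alpha> \<beta>) \<le>
          (\<Sum>\<alpha> | order_of \<alpha> \<le> s1. \<Sum>\<beta> | order_of \<beta> \<le> s2. real n powr (1 / p - 1) * b * A \<alpha> \<beta>)"
          by (intro sum_mono term_le) auto
        also have "\<dots> = real n powr (1 / p - 1) * b * (Am - 1)"
          by (simp add: Am_def sum_distrib_left)
        also have "\<dots> \<le> real n powr (1 / p - 1) * b * Am"
          using b by (intro mult_left_mono) auto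
        also have "\<dots> = (real n powr (1 / p - 1) * real n powr (1 - 1 / p)) * r"
          using Am by (simp add: b_def)
        also have "real n powr (1 / p - 1) * real n powr (1 - 1 / p) = 1"
          using elim by (simp add: powr_add[symmetric])
        finally have "(\<Sum>\<alpha> | order_of \<alpha> \<le> s1. \<Sum>\<beta> | order_of \<beta> \<le> s2. real n powr (1 / p - 1) *
            l powr (real (order_of \<alpha> + order_of \<beta>) + D - D / p) * A \<alpha> \<beta>) \<le> r" by simp
        moreover have "(rs powr (D / S) / real n) powr (- E) * (real n powr (1 - p) * l powr (D * (p - 1))) =
            Am powr (- (p * D * (p - 1) / K))"
          unfolding rs E_def using elim Am r S D assms(3)
          by (intro rate_exponent_identity) (auto simp: K_def l_def b_def)
        ultimately show ?case using l by (intro exI[of _ l]) auto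
      qed
    qed
    with eventually_gt_at_top[of 0] eventually_power_ge_quarter
    have "\<forall>\<^sub>F n in sequentially. ennreal c \<le> ennreal ((rs powr (D / S) / real n) powr (- E)) *
      minimax_risk p n (mixed_sobolev_ball s1 s2 p r :: ((real ^ 'd1) \<times> (real ^ 'd2) \<Rightarrow> real) set)"
    proof eventually_elim
      case (elim n)
      then obtain l where l: "l > 0"
        "(\<Sum>\<alpha> | order_of \<alpha> \<le> s1. \<Sum>\<beta> | order_of \<beta> \<le> s2. real n powr (1 / p - 1) *
          l powr (real (order_of \<alpha> + order_of \<beta>) + D - D / p) * A \<alpha> \<beta>) \<le> r"
        "(rs powr (D / S) / real n) powr (- E) * (real n powr (1 - p) * l powr (D * (p - 1))) =
          Am powr (- (p * D * (p - 1) / K))"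
        by blast
      have "c = (rs powr (D / S) / real n) powr (- E) *
          (J / (8 * 2 powr p) * (real n powr (1 - p) * l powr (D * (p - 1))))"
        unfolding c_def l(3)[symmetric] by simp
      then have "ennreal c = ennreal ((rs powr (D / S) / real n) powr (- E)) *
          ennreal (J / (8 * 2 powr p) * (real n powr (1 - p) * l powr (D * (p - 1))))"
        by (simp only: ennreal_mult' powr_ge_zero)
      also have "\<dots> \<le> ennreal ((rs powr (D / S) / real n) powr (- E)) *
          minimax_risk p n (mixed_sobolev_ball s1 s2 p r :: ((real ^ 'd1) \<times> (real ^ 'd2) \<Rightarrow> real) set)"
        by (intro mult_left_mono risk l) (use elim in auto)
      finally show ?case .
    qed
    then show "ennreal c \<le> liminf (\<lambda>n. ennreal ((rs powr (D / S) / real n) powr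
        (- (S * (p - 1) * p / (S * p + D * (p - 1))))) *
      minimax_risk p n (mixed_sobolev_ball s1 s2 p r :: ((real ^ 'd1) \<times> (real ^ 'd2) \<Rightarrow> real) set))"
      unfolding E_def K_def by (rule Liminf_bounded)
  qed
qed

end
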